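(* Let $D$ be a virtual link diagram and let $n$ be a non-zero integer. Then the over $n$-writhe $J^{\rm O}_n(D)$, the under $n$-writhe $J^{\rm U}_n(D)$, the over affine index polynomial $P^{\rm O}_D(t)$, the under affine index polynomial $P^{\rm U}_D(t)$ and the over-under affine index polynomial $P^{\rm OU}_D(s,t)$ are virtual link invariants; that is, if $D$ and $D'$ are equivalent virtual link diagrams, then each of these quantities takes the same value on $D$ and $D'$.
   Context: A virtual link diagram is a collection of immersed oriented loops in $\mathbb{R}^2$ whose multiple points are transverse double points, each of which is either a classical crossing (with over/under information, and with a sign ${\rm sgn}(c)\in\{+1,-1\}$ as usual in knot theory) or a virtual crossing (without over/under information). Generalized Reidemeister moves are the classical Reidemeister moves I, II, III (involving only classical crossings) and the virtual Reidemeister moves: the analogues of I, II, III in which all crossings are virtual, and the mixed move IV in which an arc with two virtual crossings is moved across a classical crossing. Two virtual link diagrams are equivalent if they are related by a finite sequence of generalized Reidemeister moves and isotopies of $\mathbb{R}^2$; a virtual link is an equivalence class. A classical self-crossing of $D$ is a classical crossing whose over path and under path lie on the same component of $D$; ${\rm Self}X(D)$ is the set of classical self-crossings. For $c\in{\rm Self}X(D)$, let $D_c$ be the diagram obtained from $D$ by smoothing at $c$ respecting the orientation. This splits the component through $c$ into two: the over counting component $D_c^{\rm O}$ is the one which leaves $c$ along the outgoing over strand and returns to $c$ along the incoming under strand; the under counting component $D_c^{\rm U}$ is the one which leaves $c$ along the outgoing under strand and returns along the incoming over strand. For $\ast\in\{{\rm O},{\rm U}\}$ let $\gamma_1,\dots,\gamma_k$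 be the sequence of classical crossings of $D$ met when travelling once along $D_c^{\ast}$ from a point near $c$ back to that point ($c$ itself is not included; crossings with other components are included; a self-crossing of $D_c^{\ast}$ appears twice). The flat sign $\iota(\gamma_i,D_c^\ast)$ is ${\rm sgn}(\gamma_i)$ if $\gamma_i$ is passed as an under crossing and $-{\rm sgn}(\gamma_i)$ if it is passed as an over crossing. The over/under affine index is ${\rm ind}^{\ast}(c)={\rm ind}^{\ast}(c,D)=\sum_i \iota(\gamma_i,D_c^{\ast})$. Define, for $n\neq 0$, $$J^{\rm O}_n(D)=\sum_{c\in{\rm Self}X(D):\ {\rm ind}^{\rm O}(c)=n,\ {\rm ind}^{\rm U}(c)\neq 0}{\rm sgn}(c),\qquad J^{\rm U}_n(D)=\sum_{c\in{\rm Self}X(D):\ {\rm ind}^{\rm U}(c)=n,\ {\rm ind}^{\rm O}(c)\neq 0}{\rm sgn}(c),$$ $$P^{\rm O}_D(t)=\sum_{c\in{\rm Self}X(D):\ {\rm ind}^{\rm U}(c)\neq 0}{\rm sgn}(c)(t^{{\rm ind}^{\rm O}(c)}-1),\qquad P^{\rm U}_D(t)=\sum_{c\in{\rm Self}X(D):\ {\rm ind}^{\rm O}(c)\neq 0}{\rm sgn}(c)(t^{{\rm ind}^{\rm U}(c)}-1),$$ $$P^{\rm OU}_D(s,t)=\sum_{c\in{\rm Self}X(D)}{\rm sgn}(c)(s^{{\rm ind}^{\rm O}(c)}-1)(t^{{\rm ind}^{\rm U}(c)}-1).$$ The polynomials are Laurent polynomials with integer coefficients. *)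

theory Defs
  imports "HOL-Analysis.Analysis" "HOL-Library.Poly_Mapping" "HOL-Library.Product_Plus"
begin

section \<open>Virtual link diagrams\<close>

type_synonym plane = "real \<times> real"

definition cross2 :: "plane \<Rightarrow> plane \<Rightarrow> real" where
  "cross2 u v = fst u * snd v - snd u * fst v"

text \<open>
  Component \<open>i < ncomp\<close> is a closed curve, given as a function on the line of period 1 and
  oriented by its parameter. A passage is a pair \<open>(i, t)\<close> with \<open>0 \<le> t < 1\<close>.
  The set \<open>over\<close> consists of the over passages of the classical crossings: a double
  point is a classical crossing if one of its two passages lies in \<open>over\<close>, and a virtual
  crossing if neither does.
\<close>

record diagram =
  ncomp :: nat
  curve :: "nat \<Rightarrow> real \<Rightarrow> plane"
  over :: "(nat \<times> real) set"

definition passages :: "diagram \<Rightarrow> (nat \<times> real) set" where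
  "passages D = {..<ncomp D} \<times> {0..<1}"

definition point :: "diagram \<Rightarrow> nat \<times> real \<Rightarrow> plane" where
  "point D x = curve D (fst x) (snd x)"

definition tangent :: "diagram \<Rightarrow> nat \<times> real \<Rightarrow> plane" where
  "tangent D x = vector_derivative (curve D (fst x)) (at (snd x))"

definition meet :: "diagram \<Rightarrow> nat \<times> real \<Rightarrow> nat \<times> real \<Rightarrow> bool" where
  "meet D x y \<longleftrightarrow> x \<in> passages D \<and> y \<in> passages D \<and> x \<noteq> y \<and> point D x = point D y"

definition immersed_loop :: "(real \<Rightarrow> plane) \<Rightarrow> bool" where
  "immersed_loop g \<longleftrightarrow>
     (\<forall>t. g (t + 1) = g t) \<and> g C1_differentiable_on UNIV \<and>
     (\<forall>t. vector_derivative g (at t) \<noteq> 0)"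

definition virtual_link_diagram :: "diagram \<Rightarrow> bool" where
  "virtual_link_diagram D \<longleftrightarrow>
     (\<forall>i<ncomp D. immersed_loop (curve D i)) \<and>
     finite {x. \<exists>y. meet D x y} \<and>
     (\<forall>x y z. meet D x y \<and> meet D x z \<longrightarrow> y = z) \<and>
     (\<forall>x y. meet D x y \<longrightarrow> cross2 (tangent D x) (tangent D y) \<noteq> 0) \<and>
     (\<forall>x\<in>over D. \<exists>y. meet D x y \<and> y \<notin> over D)"


section \<open>Equivalence\<close>

definition C1_diffeo :: "(plane \<Rightarrow> plane) \<Rightarrow> (plane \<Rightarrow> plane \<Rightarrow>\<^sub>L plane) \<Rightarrow> bool" where
  "C1_diffeo f f' \<longleftrightarrow>
     bij f \<and> (\<forall>x. (f has_derivative blinfun_apply (f' x)) (at x)) \<and>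
     continuous_on UNIV f' \<and> (\<forall>x. bij (blinfun_apply (f' x)))"

definition isotopic :: "diagram \<Rightarrow> diagram \<Rightarrow> bool" where
  "isotopic D E \<longleftrightarrow>
     (\<exists>H H'. (\<forall>u\<in>{0..1::real}. C1_diffeo (H u) (H' u)) \<and>
        continuous_on ({0..1} \<times> UNIV) (\<lambda>(u, x). H u x) \<and>
        continuous_on ({0..1} \<times> UNIV) (\<lambda>(u, x). H' u x) \<and>
        H 0 = id \<and> ncomp E = ncomp D \<and>
        (\<forall>i<ncomp D. \<forall>t. curve E i t = H 1 (curve D i t)) \<and>
        over E = over D)"

text \<open>
  A diagram consists of unparametrised, unlabelled oriented loops: renumbering the components
  and orientation-preserving changes of parameter do not change it.
\<close>

definition circle_reparam :: "(real \<Rightarrow> real) \<Rightarrow> bool" where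
  "circle_reparam \<rho> \<longleftrightarrow>
     (\<forall>t. \<rho> (t + 1) = \<rho> t + 1) \<and> \<rho> C1_differentiable_on UNIV \<and> (\<forall>t. deriv \<rho> t > 0)"

definition same_loops :: "diagram \<Rightarrow> diagram \<Rightarrow> bool" where
  "same_loops D E \<longleftrightarrow>
     ncomp E = ncomp D \<and>
     (\<exists>\<sigma> \<rho>. bij_betw \<sigma> {..<ncomp D} {..<ncomp D} \<and>
        (\<forall>i<ncomp D. circle_reparam (\<rho> i) \<and> (\<forall>t. curve E i t = curve D (\<sigma> i) (\<rho> i t))) \<and>
        over E = {(i, t). (i, t) \<in> passages E \<and> (\<sigma> i, frac (\<rho> i t)) \<in> over D})"

text \<open>
  A tangle with \<open>k\<close> strands consists of curves \<open>T j\<close> (\<open>j < k\<close>) on \<open>{-1..1}\<close> in the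
  square \<open>box2\<close>, with end points on its boundary, and of the set \<open>W\<close> of over passages.
  In a local move the diagrams \<open>D\<close> and \<open>E\<close> coincide outside the image of the
  square under the chart \<open>\<phi>\<close>, where they are the images of two tangles.
  Strand \<open>j\<close> is the part of component \<open>ix j\<close> with parameters \<open>m j + r j * s\<close>,
  \<open>-1 \<le> s \<le> 1\<close>; the sign of \<open>r j\<close> makes all orientations of the strands possible, and
  \<open>\<phi>\<close> may reverse the orientation of the plane. That the arcs have parameters in \<open>{0<..<1}\<close>
  is no restriction, by \<open>same_loops\<close>.
\<close>

type_synonym tangle = "nat \<Rightarrow> real \<Rightarrow> plane"

definition box2 :: "plane set" where
  "box2 = {-1..1} \<times> {-1..1}"

definition local_move ::
  "nat \<Rightarrow> tangle \<Rightarrow> (nat \<times> real) set \<Rightarrow> tangle \<Rightarrow> (nat \<times> real) set \<Rightarrow> diagram \<Rightarrow> diagram \<Rightarrow> bool"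
where
  "local_move k T W T' W' D E \<longleftrightarrow>
     ncomp E = ncomp D \<and>
     (\<exists>\<phi> \<phi>' ix m r. C1_diffeo \<phi> \<phi>' \<and>
        (\<forall>j<k. ix j < ncomp D \<and> r j \<noteq> 0 \<and> 0 < m j - \<bar>r j\<bar> \<and> m j + \<bar>r j\<bar> < 1) \<and>
        (let arc = (\<lambda>j. (\<lambda>s. (ix j, m j + r j * s)) ` {-1..1}) in
         (\<forall>i<k. \<forall>j<k. i \<noteq> j \<longrightarrow> arc i \<inter> arc j = {}) \<and>
         (\<forall>x \<in> passages D - (\<Union>j<k. arc j).
            point D x \<notin> \<phi> ` box2 \<and> point E x = point D x \<and> (x \<in> over E \<longleftrightarrow> x \<in> over D))) \<and>
        (\<forall>j<k. \<forall>s\<in>{-1..1}.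
           point D (ix j, m j + r j * s) = \<phi> (T j s) \<and>
           point E (ix j, m j + r j * s) = \<phi> (T' j s) \<and>
           ((ix j, m j + r j * s) \<in> over D \<longleftrightarrow> (j, s) \<in> W) \<and>
           ((ix j, m j + r j * s) \<in> over E \<longleftrightarrow> (j, s) \<in> W')))"

text \<open>
  Over passages of a tangle without self-crossings in which the crossings of strands \<open>p\<close>
  and \<open>q\<close> are classical with \<open>p\<close> above \<open>q\<close> if \<open>(p, q) \<in> A\<close>, and virtual if
  neither \<open>(p, q)\<close> nor \<open>(q, p)\<close> is in \<open>A\<close>.
\<close>

definition over_passages :: "nat \<Rightarrow> tangle \<Rightarrow> (nat \<times> nat) set \<Rightarrow> (nat \<times> real) set" where
  "over_passages k T A =
     {(p, s). p < k \<and> s \<in> {-1..1} \<and> (\<exists>q<k. \<exists>s'\<in>{-1..1}. (p, q) \<in> A \<and> T p s = T q s')}"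

text \<open>
  Concrete pictures for the moves. The two tangles of a move agree to first order at the end
  points of the strands, so that each can replace the other in a \<open>C\<^sup>1\<close> curve. The kink crosses
  itself at the parameters \<open>\<plusminus>1/2\<close>; the strands of the bigon cross at \<open>\<plusminus>1/2\<close>; strands 0 and 1
  of the triangles cross at \<open>0\<close>, and strand 2 crosses the other two at \<open>\<plusminus>1/2\<close>, passing
  above the crossing of 0 and 1 in the plane if \<open>e = 1\<close>, and below it if \<open>e = -1\<close>.
\<close>

definition kink :: tangle where
  "kink j s = (s ^ 3 - s / 4, s\<^sup>2)"

definition no_kink :: tangle where
  "no_kink j s = (s ^ 5 / 2 + s / 4, s\<^sup>2)"

definition bigon :: tangle where
  "bigon j s = (s, if j = 0 then 0 else s\<^sup>2 - 1 / 4)"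

definition no_bigon :: tangle where
  "no_bigon j s = (s, if j = 0 then 0 else s ^ 4 - s\<^sup>2 + 3 / 4)"

definition triangle :: "real \<Rightarrow> tangle" where
  "triangle e j s =
     (s, if j = 0 then s / 2 else if j = 1 then - s / 2 else e * (4 / 9) * (1 - s\<^sup>2)\<^sup>2)"

definition move1 :: "(nat \<times> real) set \<Rightarrow> diagram \<Rightarrow> diagram \<Rightarrow> bool" where
  "move1 W = local_move 1 kink W no_kink {}"

definition move2 :: "(nat \<times> nat) set \<Rightarrow> diagram \<Rightarrow> diagram \<Rightarrow> bool" where
  "move2 A = local_move 2 bigon (over_passages 2 bigon A) no_bigon {}"

definition move3 :: "(nat \<times> nat) set \<Rightarrow> diagram \<Rightarrow> diagram \<Rightarrow> bool" where
  "move3 A = local_move 3 (triangle 1) (over_passages 3 (triangle 1) A)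
                          (triangle (-1)) (over_passages 3 (triangle (-1)) A)"

inductive generalized_reidemeister :: "diagram \<Rightarrow> diagram \<Rightarrow> bool" where
  classical_I: "W = {(0, 1/2)} \<or> W = {(0, -1/2)} \<Longrightarrow> move1 W D E \<Longrightarrow> generalized_reidemeister D E"
| classical_II: "A = {(0, 1)} \<or> A = {(1, 0)} \<Longrightarrow> move2 A D E \<Longrightarrow> generalized_reidemeister D E"
| classical_III: "inj_on h {..<3} \<Longrightarrow> A = {(p, q). p < 3 \<and> q < 3 \<and> (h p :: nat) > h q} \<Longrightarrow>
    move3 A D E \<Longrightarrow> generalized_reidemeister D E"
| virtual_I: "move1 {} D E \<Longrightarrow> generalized_reidemeister D E"
| virtual_II: "move2 {} D E \<Longrightarrow> generalized_reidemeister D E"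
| virtual_III: "move3 {} D E \<Longrightarrow> generalized_reidemeister D E"
| mixed_IV: "A = {(0, 1)} \<or> A = {(1, 0)} \<Longrightarrow> move3 A D E \<Longrightarrow> generalized_reidemeister D E"

definition elementary_step :: "diagram \<Rightarrow> diagram \<Rightarrow> bool" where
  "elementary_step D E \<longleftrightarrow>
     virtual_link_diagram D \<and> virtual_link_diagram E \<and>
     (same_loops D E \<or> isotopic D E \<or> generalized_reidemeister D E)"

definition equivalent :: "diagram \<Rightarrow> diagram \<Rightarrow> bool" where
  "equivalent = equivclp elementary_step"


section \<open>Over and under affine indices\<close>

text \<open>A classical crossing is represented by the pair of its over and its under passage.\<close>

type_synonym crossing = "(nat \<times> real) \<times> (nat \<times> real)"

definition classical :: "diagram \<Rightarrow> crossing set" where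
  "classical D = {(x, y). meet D x y \<and> x \<in> over D}"

definition crossing_sign :: "diagram \<Rightarrow> crossing \<Rightarrow> int" where
  "crossing_sign D c = (if cross2 (tangent D (fst c)) (tangent D (snd c)) > 0 then 1 else -1)"

definition SelfX :: "diagram \<Rightarrow> crossing set" where
  "SelfX D = {c \<in> classical D. fst (fst c) = fst (snd c)}"

text \<open>
  The parameters strictly after \<open>s\<close> and strictly before \<open>t\<close> on the oriented circle
  \<open>{0..<1}\<close>.
\<close>

definition open_arc :: "real \<Rightarrow> real \<Rightarrow> real set" where
  "open_arc s t =
     {u \<in> {0..<1}. if s < t then s < u \<and> u < t else s < u \<or> u < t}"

text \<open>
  The counting components are given by the passages of the original diagram met on them, that
  is, without the two passages through \<open>c\<close>.
\<close>

definition over_component :: "crossing \<Rightarrow> (nat \<times> real) set" where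
  "over_component c = {fst (fst c)} \<times> open_arc (snd (fst c)) (snd (snd c))"

definition under_component :: "crossing \<Rightarrow> (nat \<times> real) set" where
  "under_component c = {fst (fst c)} \<times> open_arc (snd (snd c)) (snd (fst c))"

definition classical_passages :: "diagram \<Rightarrow> (nat \<times> real) set" where
  "classical_passages D = fst ` classical D \<union> snd ` classical D"

definition crossing_at :: "diagram \<Rightarrow> nat \<times> real \<Rightarrow> crossing" where
  "crossing_at D x = (THE c. c \<in> classical D \<and> (fst c = x \<or> snd c = x))"

definition flat_sign :: "diagram \<Rightarrow> nat \<times> real \<Rightarrow> int" where
  "flat_sign D x =
     (if x \<in> over D then - crossing_sign D (crossing_at D x) else crossing_sign D (crossing_at D x))"

definition ind_O :: "diagram \<Rightarrow> crossing \<Rightarrow> int" where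
  "ind_O D c = (\<Sum>x \<in> classical_passages D \<inter> over_component c. flat_sign D x)"

definition ind_U :: "diagram \<Rightarrow> crossing \<Rightarrow> int" where
  "ind_U D c = (\<Sum>x \<in> classical_passages D \<inter> under_component c. flat_sign D x)"


section \<open>Writhes and affine index polynomials\<close>

definition J_O :: "int \<Rightarrow> diagram \<Rightarrow> int" where
  "J_O n D = (\<Sum>c \<in> {c \<in> SelfX D. ind_O D c = n \<and> ind_U D c \<noteq> 0}. crossing_sign D c)"

definition J_U :: "int \<Rightarrow> diagram \<Rightarrow> int" where
  "J_U n D = (\<Sum>c \<in> {c \<in> SelfX D. ind_U D c = n \<and> ind_O D c \<noteq> 0}. crossing_sign D c)"

text \<open>
  Laurent polynomials over the integers form the group rings of \<open>int\<close> and \<open>int \<times> int\<close>;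
  multiplication in \<^type>\<open>poly_mapping\<close> is convolution.
\<close>

type_synonym laurent = "int \<Rightarrow>\<^sub>0 int"
type_synonym laurent2 = "(int \<times> int) \<Rightarrow>\<^sub>0 int"

definition t_pow :: "int \<Rightarrow> laurent" where
  "t_pow k = Poly_Mapping.single k 1"

definition s_pow2 :: "int \<Rightarrow> laurent2" where
  "s_pow2 k = Poly_Mapping.single (k, 0) 1"

definition t_pow2 :: "int \<Rightarrow> laurent2" where
  "t_pow2 k = Poly_Mapping.single (0, k) 1"

definition P_O :: "diagram \<Rightarrow> laurent" where
  "P_O D = (\<Sum>c \<in> {c \<in> SelfX D. ind_U D c \<noteq> 0}.
              of_int (crossing_sign D c) * (t_pow (ind_O D c) - 1))"

definition P_U :: "diagram \<Rightarrow> laurent" where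
  "P_U D = (\<Sum>c \<in> {c \<in> SelfX D. ind_O D c \<noteq> 0}.
              of_int (crossing_sign D c) * (t_pow (ind_U D c) - 1))"

definition P_OU :: "diagram \<Rightarrow> laurent2" where
  "P_OU D = (\<Sum>c \<in> SelfX D.
               of_int (crossing_sign D c) * (s_pow2 (ind_O D c) - 1) * (t_pow2 (ind_U D c) - 1))"

end

theory Submission
  imports Defs
begin

text \<open>
  Each of the five invariants is a sum over the self-crossings \<open>c\<close> of
  \<open>sgn c * F (ind_O c) (ind_U c)\<close> for some \<open>F\<close> that vanishes when one of its arguments is 0
  (\<open>J_O_index_sum\<close> to \<open>P_OU_index_sum\<close>). So it suffices to show that every such sum is
  unchanged by an elementary step.

  The flat sign of a passage is the orientation of the frame formed by the tangent of the
  branch crossed and the tangent of the passage itself (\<open>weight_meet\<close>): exchanging over and under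
  changes the sign of the crossing and also the sign put in front of it. Both indices of a
  self-crossing are therefore intersection numbers of a stretch of one component with the other
  classical branches, and the over and the under index differ only in the direction in which
  one travels between the two passages. It is enough to study one function, the index
  \<open>route_index D x y\<close> of the stretch from \<open>x\<close> to \<open>y\<close>.

  A change of parameter and an isotopy induce a bijection of passages that respects crossings,
  cyclic order and frame orientations; for the isotopy the last point holds because the Jacobian
  determinant starts at 1 and never vanishes.

  In a local move the diagram splits into the part outside the chart, which does not change, and
  the strands inside. All classical crossings inside occur at the strand parameters
  \<open>-1/2, 0, 1/2\<close>. If the total weight of every strand is the same for both tangles, then
  crossings outside keep their indices, because a stretch with end points outside contains each
  strand wholly or not at all. The index of a crossing inside between distinct strands \<open>p\<close> and
  \<open>q\<close> is a term common to both tangles plus the weights on \<open>p\<close> after the crossing and on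
  \<open>q\<close> before it (\<open>route_index_between\<close>). The moves now follow by inspection:

  \<^item> The crossing of a kink cuts off a loop that meets nothing classical, so one of its
    indices is 0 and \<open>F\<close> kills its contribution; the two weights of the kink cancel.

  \<^item> The two crossings of a bigon have opposite signs and equal indices; their weights cancel
    on each strand.

  \<^item> In a triangle move each crossing keeps its sign, and on every strand the two crossings
    change places. Whatever the orientations of the strands, the third strand crosses the
    corner path at a crossing with the same total sign on both sides of the move.

  \<^item> If all crossings inside are virtual, nothing inside counts.
\<close>

section \<open>Signs and the plane\<close>

text \<open>
  Passages are pairs; facts about crossings are stated for passages as such, so quantifiers over
  passages must not be split into quantifiers over the coordinates.
\<close>
declare split_paired_All [simp del] split_paired_Ex [simp del]

text \<open>
  The value at 0 follows the convention of \<^const>\<open>crossing_sign\<close>; at the crossings of a diagram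
  the argument is nonzero by transversality.
\<close>
definition rsign :: "real \<Rightarrow> int" where
  "rsign a = (if a > 0 then 1 else -1)"

lemma rsign_mult: "a \<noteq> 0 \<Longrightarrow> b \<noteq> 0 \<Longrightarrow> rsign (a * b) = rsign a * rsign b"
  by (auto simp: rsign_def zero_less_mult_iff)

lemma rsign_mult_pos: "a > 0 \<Longrightarrow> rsign (a * b) = rsign b"
  by (simp add: rsign_def zero_less_mult_iff)

lemma rsign_minus: "a \<noteq> 0 \<Longrightarrow> rsign (- a) = - rsign a"
  by (auto simp: rsign_def)

lemma rsign_pos: "a > 0 \<Longrightarrow> rsign a = 1"
  and rsign_neg: "a < 0 \<Longrightarrow> rsign a = -1"
  by (auto simp: rsign_def)

lemma rsign_inverse: "rsign (inverse a) = rsign a"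
  by (simp add: rsign_def)

lemma cross2_scaleR: "cross2 (a *\<^sub>R u) (b *\<^sub>R v) = a * b * cross2 u v"
  by (simp add: cross2_def algebra_simps)

lemma cross2_swap: "cross2 v u = - cross2 u v"
  by (simp add: cross2_def)

text \<open>
  The factor is the determinant of \<open>f\<close>, written out on the standard basis.
\<close>
lemma cross2_linear_image:
  fixes f :: "plane \<Rightarrow> plane"
  assumes "linear f"
  shows "cross2 (f u) (f v) = cross2 (f (1, 0)) (f (0, 1)) * cross2 u v"
proof -
  have *: "f w = fst w *\<^sub>R f (1, 0) + snd w *\<^sub>R f (0, 1)" for w
  proof -
    have "f (fst w *\<^sub>R (1, 0) + snd w *\<^sub>R (0, 1)) = fst w *\<^sub>R f (1, 0) + snd w *\<^sub>R f (0, 1)"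
      by (simp only: linear_add[OF assms] linear_scale[OF assms])
    moreover have "fst w *\<^sub>R (1, 0) + snd w *\<^sub>R (0, 1) = w" by (simp add: prod_eq_iff)
    ultimately show ?thesis by simp
  qed
  show ?thesis
    unfolding *[of u] *[of v] by (simp add: cross2_def algebra_simps)
qed

lemma det_nonzero_if_inj:
  fixes f :: "plane \<Rightarrow> plane"
  assumes f: "linear f" and inj: "inj f"
  shows "cross2 (f (1, 0)) (f (0, 1)) \<noteq> 0"
proof
  assume 0: "cross2 (f (1, 0)) (f (0, 1)) = 0"
  obtain a b where a: "f (1, 0) = (a, b)" by (cases "f (1, 0)")
  obtain c d where c: "f (0, 1) = (c, d)" by (cases "f (0, 1)")
  have *: "f (x, y) = (x * a + y * c, x * b + y * d)" for x y
  proof -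
    have "f (x *\<^sub>R (1, 0) + y *\<^sub>R (0, 1)) = x *\<^sub>R f (1, 0) + y *\<^sub>R f (0, 1)"
      by (simp only: linear_add[OF f] linear_scale[OF f])
    then show ?thesis by (simp add: a c)
  qed
  have ad: "a * d = b * c" using 0 by (simp add: a c cross2_def)
  have z: "f (0, 0) = (0, 0)" by (simp add: *)
  have "f (d, - b) = f (0, 0)" "f (c, - a) = f (0, 0)" using ad by (simp_all add: * algebra_simps)
  then have "(d, - b) = (0, 0)" "(c, - a) = (0, 0)"
    by (simp_all only: inj_eq[OF inj])
  then have "f (1, 0) = f (0, 0)" by (simp add: a z)
  then have "(1, 0) = (0::real, 0::real)" by (simp only: inj_eq[OF inj])
  then show False by simp
qed

section \<open>Indices as weighted counts along routes\<close>

text \<open>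
  The counting components of a self-crossing are the routes between its two passages, one
  for each direction.
\<close>

definition route :: "nat \<times> real \<Rightarrow> nat \<times> real \<Rightarrow> (nat \<times> real) set" where
  "route x y = {fst x} \<times> open_arc (snd x) (snd y)"

definition route_index :: "diagram \<Rightarrow> nat \<times> real \<Rightarrow> nat \<times> real \<Rightarrow> int" where
  "route_index D x y = (\<Sum>z \<in> classical_passages D \<inter> route x y. flat_sign D z)"

text \<open>
  The flat sign extended by 0, so that the indices in two diagrams can be written as sums
  over one and the same set of passages.
\<close>
definition weight :: "diagram \<Rightarrow> nat \<times> real \<Rightarrow> int" where
  "weight D x = (if x \<in> classical_passages D then flat_sign D x else 0)"

definition index_sum :: "(int \<Rightarrow> int \<Rightarrow> 'a::comm_ring_1) \<Rightarrow> diagram \<Rightarrow> 'a" where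
  "index_sum F D = (\<Sum>c \<in> SelfX D. of_int (crossing_sign D c) * F (ind_O D c) (ind_U D c))"

lemma ind_O_route: "ind_O D c = route_index D (fst c) (snd c)"
  by (simp add: ind_O_def route_index_def route_def over_component_def)

text \<open>
  Only for a self-crossing does the route from the under to the over passage lie on the component
  named in \<^const>\<open>under_component\<close>, which is that of the over passage.
\<close>
lemma ind_U_route: "c \<in> SelfX D \<Longrightarrow> ind_U D c = route_index D (snd c) (fst c)"
  by (simp add: SelfX_def ind_U_def route_index_def route_def under_component_def)

lemma meet_sym: "meet D x y \<Longrightarrow> meet D y x"
  by (auto simp: meet_def)

lemma crossing_sign_rsign:
  "crossing_sign D (x, y) = rsign (cross2 (tangent D x) (tangent D y))"
  by (simp add: crossing_sign_def rsign_def)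

lemma classical_iff: "(x, y) \<in> classical D \<longleftrightarrow> meet D x y \<and> x \<in> over D"
  by (simp add: classical_def)

lemma classical_passages_iff:
  "x \<in> classical_passages D \<longleftrightarrow> (\<exists>y. meet D x y \<and> (x \<in> over D \<or> y \<in> over D))"
proof
  assume "x \<in> classical_passages D"
  then obtain c where c: "c \<in> classical D" "x = fst c \<or> x = snd c"
    by (auto simp: classical_passages_def)
  moreover obtain a b where "c = (a, b)" by (cases c)
  ultimately have "meet D a b" "a \<in> over D" "x = a \<or> x = b"
    by (auto simp: classical_iff)
  then show "\<exists>y. meet D x y \<and> (x \<in> over D \<or> y \<in> over D)"
    using meet_sym by blast
next
  assume "\<exists>y. meet D x y \<and> (x \<in> over D \<or> y \<in> over D)"
  then obtain y where "(x, y) \<in> classical D \<or> (y, x) \<in> classical D"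
    by (auto simp: classical_iff intro: meet_sym)
  then show "x \<in> classical_passages D"
    unfolding classical_passages_def by (force simp: image_iff)
qed

context
  fixes D
  assumes D: "virtual_link_diagram D"
begin

lemma meet_unique: "meet D x y \<Longrightarrow> meet D x z \<Longrightarrow> y = z"
  using D by (simp add: virtual_link_diagram_def)

lemma transverse: "meet D x y \<Longrightarrow> cross2 (tangent D x) (tangent D y) \<noteq> 0"
  using D by (simp add: virtual_link_diagram_def)

lemma over_partner:
  assumes "x \<in> over D" "meet D x y"
  shows "y \<notin> over D"
proof -
  have "\<exists>y. meet D x y \<and> y \<notin> over D"
    using D assms(1) by (simp add: virtual_link_diagram_def)
  then show ?thesis using meet_unique assms(2) by metis
qed

lemma immersed: "i < ncomp D \<Longrightarrow> immersed_loop (curve D i)"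
  using D by (simp add: virtual_link_diagram_def)

lemma finite_classical_passages: "finite (classical_passages D)"
proof (rule finite_subset)
  show "classical_passages D \<subseteq> {x. \<exists>y. meet D x y}"
    by (auto simp: classical_passages_iff)
  show "finite {x. \<exists>y. meet D x y}"
    using D by (simp add: virtual_link_diagram_def)
qed

lemma finite_classical: "finite (classical D)"
proof (rule finite_subset)
  show "classical D \<subseteq> classical_passages D \<times> classical_passages D"
    by (rule subsetI) (simp add: classical_passages_def mem_Times_iff)
  show "finite (classical_passages D \<times> classical_passages D)"
    by (simp add: finite_classical_passages)
qed

lemma finite_SelfX: "finite (SelfX D)"
  using finite_classical by (simp add: SelfX_def)

lemma crossing_at_eq:
  assumes "(x, y) \<in> classical D"
  shows "crossing_at D x = (x, y)" "crossing_at D y = (x, y)"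
proof -
  have xy: "meet D x y" "x \<in> over D" "y \<notin> over D"
    using assms over_partner[of x y] by (auto simp only: classical_iff)
  show "crossing_at D x = (x, y)"
    unfolding crossing_at_def
  proof (rule the_equality)
    fix c assume "c \<in> classical D \<and> (fst c = x \<or> snd c = x)"
    moreover obtain a b where "c = (a, b)" by (cases c)
    ultimately have "meet D a b" "a \<in> over D" "a = x \<or> b = x" and c: "c = (a, b)"
      by (auto simp: classical_iff)
    then show "c = (x, y)"
      using xy meet_unique meet_sym over_partner by metis
  qed (use assms in auto)
  show "crossing_at D y = (x, y)"
    unfolding crossing_at_def
  proof (rule the_equality)
    fix c assume "c \<in> classical D \<and> (fst c = y \<or> snd c = y)"
    moreover obtain a b where "c = (a, b)" by (cases c)
    ultimately have "meet D a b" "a \<in> over D" "a = y \<or> b = y" and c: "c = (a, b)"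
      by (auto simp: classical_iff)
    then show "c = (x, y)"
      using xy meet_unique meet_sym over_partner by metis
  qed (use assms in auto)
qed

text \<open>
  The frame of the crossed branch and the passing branch: with over and under exchanged, both the
  crossing sign and the sign in front of it in \<^const>\<open>flat_sign\<close> change. In particular the two
  passages of a classical crossing have opposite weights.
\<close>
lemma weight_meet:
  assumes m: "meet D x y"
  shows "weight D x = (if x \<in> over D \<or> y \<in> over D
    then rsign (cross2 (tangent D y) (tangent D x)) else 0)"
proof (cases "x \<in> over D \<or> y \<in> over D")
  case False
  then have "x \<notin> classical_passages D"
    using m by (auto simp: classical_passages_iff dest: meet_unique)
  then show ?thesis using False by (simp add: weight_def)
next
  case True
  then have cp: "x \<in> classical_passages D" using m by (auto simp: classical_passages_iff)
  show ?thesis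
  proof (cases "x \<in> over D")
    case True
    then have "crossing_at D x = (x, y)" by (simp add: crossing_at_eq classical_iff m)
    then have "flat_sign D x = - rsign (cross2 (tangent D x) (tangent D y))"
      using True by (simp add: flat_sign_def crossing_sign_rsign)
    also have "\<dots> = rsign (cross2 (tangent D y) (tangent D x))"
      using rsign_minus[OF transverse[OF m]] by (simp add: cross2_swap[of "tangent D y"])
    finally show ?thesis using True cp by (simp add: weight_def)
  next
    case False
    then have "(y, x) \<in> classical D" using \<open>x \<in> over D \<or> y \<in> over D\<close> m
      by (simp add: classical_iff meet_sym)
    then have "crossing_at D x = (y, x)" by (rule crossing_at_eq)
    then show ?thesis using cp True False
      by (simp add: weight_def flat_sign_def crossing_sign_rsign)
  qed
qed

lemma crossing_sign_weight: "(x, y) \<in> classical D \<Longrightarrow> crossing_sign D (x, y) = weight D y"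
  using weight_meet[OF meet_sym, of x y] by (simp add: classical_iff crossing_sign_rsign)

lemma route_index_weight:
  assumes "finite Z" "classical_passages D \<subseteq> Z"
  shows "route_index D x y = (\<Sum>z\<in>Z. if z \<in> route x y then weight D z else 0)"
proof -
  have "route_index D x y = (\<Sum>z \<in> classical_passages D \<inter> route x y. weight D z)"
    unfolding route_index_def by (rule sum.cong) (auto simp: weight_def)
  also have "\<dots> = (\<Sum>z\<in>classical_passages D. if z \<in> route x y then weight D z else 0)"
    by (rule sum.inter_restrict) (rule finite_classical_passages)
  also have "\<dots> = (\<Sum>z\<in>Z. if z \<in> route x y then weight D z else 0)"
    by (rule sum.mono_neutral_left) (use assms in \<open>auto simp: weight_def\<close>)
  finally show ?thesis .
qed

end

section \<open>Bijections of passages\<close>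

text \<open>
  Signs, indices and the property of being a self-crossing depend only on the data preserved
  here. A single criterion thus serves both for changes of parameter and for isotopies.
\<close>

lemma index_sum_passage_bijection:
  assumes D: "virtual_link_diagram D" and E: "virtual_link_diagram E"
    and b: "bij_betw b (passages E) (passages D)"
    and meet: "\<And>x y. x \<in> passages E \<Longrightarrow> y \<in> passages E \<Longrightarrow> meet D (b x) (b y) \<longleftrightarrow> meet E x y"
    and over: "\<And>x. x \<in> passages E \<Longrightarrow> b x \<in> over D \<longleftrightarrow> x \<in> over E"
    and sign: "\<And>x y. meet E x y \<Longrightarrow> rsign (cross2 (tangent D (b x)) (tangent D (b y)))
                  = rsign (cross2 (tangent E x) (tangent E y))"
    and comp: "\<And>x y. x \<in> passages E \<Longrightarrow> y \<in> passages E \<Longrightarrow>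
                  fst (b x) = fst (b y) \<longleftrightarrow> fst x = fst y"
    and route: "\<And>x y z. x \<in> passages E \<Longrightarrow> y \<in> passages E \<Longrightarrow> z \<in> passages E \<Longrightarrow>
                  fst x = fst y \<Longrightarrow> b z \<in> route (b x) (b y) \<longleftrightarrow> z \<in> route x y"
  shows "index_sum F D = index_sum F E"
proof -
  have mp: "x \<in> passages C \<and> y \<in> passages C" if "meet C x y" for C x y
    using that by (simp add: meet_def)
  have inj: "inj_on b (passages E)" using b by (simp add: bij_betw_def)
  have surj: "\<exists>x\<in>passages E. b x = u" if "u \<in> passages D" for u
  proof -
    have "u \<in> b ` passages E" using b that by (simp add: bij_betw_def)
    then show ?thesis by blast
  qed
  have cp: "b x \<in> classical_passages D \<longleftrightarrow> x \<in> classical_passages E" if x: "x \<in> passages E" for x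
  proof -
    have "(\<exists>v. meet D (b x) v \<and> (b x \<in> over D \<or> v \<in> over D))
        \<longleftrightarrow> (\<exists>y\<in>passages E. meet D (b x) (b y) \<and> (b x \<in> over D \<or> b y \<in> over D))"
      using mp surj by blast
    also have "\<dots> \<longleftrightarrow> (\<exists>y\<in>passages E. meet E x y \<and> (x \<in> over E \<or> y \<in> over E))"
      using x meet over by blast
    also have "\<dots> \<longleftrightarrow> (\<exists>y. meet E x y \<and> (x \<in> over E \<or> y \<in> over E))"
      using mp by blast
    finally show ?thesis unfolding classical_passages_iff .
  qed
  have cpE: "classical_passages E \<subseteq> passages E" for E
    by (auto simp: classical_passages_iff meet_def)
  have w: "weight D (b x) = weight E x" if x: "x \<in> passages E" for x
  proof (cases "x \<in> classical_passages E")
    case True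
    then obtain y where y: "meet E x y" "x \<in> over E \<or> y \<in> over E"
      by (auto simp: classical_passages_iff)
    have "meet D (b x) (b y)" using y meet mp by blast
    then show ?thesis
      using y(2) over[OF x] over[of y] mp[OF y(1)] sign[OF meet_sym[OF y(1)]]
      by (simp add: weight_meet[OF D] weight_meet[OF E y(1)])
  qed (simp add: weight_def cp[OF x])
  have bcp: "bij_betw b (classical_passages E) (classical_passages D)"
    unfolding bij_betw_def
  proof
    show "inj_on b (classical_passages E)" using inj cpE inj_on_subset by blast
    show "b ` classical_passages E = classical_passages D"
      using cpE surj cp by blast
  qed
  have ri: "route_index D (b x) (b y) = route_index E x y"
    if "x \<in> passages E" "y \<in> passages E" "fst x = fst y" for x y
  proof -
    have "route_index D (b x) (b y)
        = (\<Sum>z\<in>classical_passages D. if z \<in> route (b x) (b y) then weight D z else 0)"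
      by (rule route_index_weight[OF D finite_classical_passages[OF D]]) simp
    also have "\<dots> = (\<Sum>z\<in>classical_passages E.
        if b z \<in> route (b x) (b y) then weight D (b z) else 0)"
      by (rule sum.reindex_bij_betw[symmetric]) (rule bcp)
    also have "\<dots> = (\<Sum>z\<in>classical_passages E. if z \<in> route x y then weight E z else 0)"
      by (rule sum.cong) (use cpE that route w in \<open>auto simp: subset_iff\<close>)
    also have "\<dots> = route_index E x y"
      by (rule route_index_weight[OF E finite_classical_passages[OF E], symmetric]) simp
    finally show ?thesis .
  qed
  let ?b = "map_prod b b"
  have SE: "fst c \<in> passages E \<and> snd c \<in> passages E \<and> fst (fst c) = fst (snd c)
      \<and> (fst c, snd c) \<in> classical E" if "c \<in> SelfX E" for c
    using that by (auto simp: SelfX_def classical_def meet_def)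
  have bS: "bij_betw ?b (SelfX E) (SelfX D)"
    unfolding bij_betw_def
  proof
    show "inj_on ?b (SelfX E)"
      by (rule inj_onI) (use SE inj in \<open>auto simp: prod_eq_iff inj_on_def\<close>)
    show "?b ` SelfX E = SelfX D"
    proof (intro set_eqI iffI)
      fix c assume "c \<in> ?b ` SelfX E"
      then obtain x y where xy: "(x, y) \<in> SelfX E" "c = (b x, b y)" by force
      then have "meet E x y" "x \<in> over E" "fst x = fst y" by (auto simp: SelfX_def classical_def)
      then show "c \<in> SelfX D"
        using xy meet over comp mp by (auto simp: SelfX_def classical_def)
    next
      fix c assume c: "c \<in> SelfX D"
      obtain u v where uv: "c = (u, v)" by (cases c)
      have m: "meet D u v" "u \<in> over D" "fst u = fst v"
        using c uv by (auto simp: SelfX_def classical_def)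
      obtain x y where xy: "x \<in> passages E" "y \<in> passages E" "b x = u" "b y = v"
        using m mp surj by meson
      then have "(x, y) \<in> SelfX E" "?b (x, y) = c"
        using m uv meet[OF xy(1,2)] over[OF xy(1)] comp[OF xy(1,2)]
        by (simp_all add: SelfX_def classical_def)
      then show "c \<in> ?b ` SelfX E" by blast
    qed
  qed
  have "index_sum F D = (\<Sum>c\<in>SelfX E. of_int (crossing_sign D (?b c))
      * F (ind_O D (?b c)) (ind_U D (?b c)))"
    unfolding index_sum_def by (rule sum.reindex_bij_betw[symmetric]) (rule bS)
  also have "\<dots> = index_sum F E"
    unfolding index_sum_def
  proof (rule sum.cong[OF refl])
    fix c assume c: "c \<in> SelfX E"
    obtain x y where xy: "c = (x, y)" by (cases c)
    have c': "?b c \<in> SelfX D" using bS c by (auto simp: bij_betw_def)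
    have p: "x \<in> passages E" "y \<in> passages E" "fst x = fst y" "meet E x y"
      using SE[OF c] xy by (auto simp: classical_def)
    have "crossing_sign D (?b c) = crossing_sign E c"
      using sign[OF p(4)] by (simp add: xy crossing_sign_rsign)
    then show "of_int (crossing_sign D (?b c)) * F (ind_O D (?b c)) (ind_U D (?b c))
        = of_int (crossing_sign E c) * F (ind_O E c) (ind_U E c)"
      using ri[of x y] ri[of y x] p ind_U_route[OF c] ind_U_route[OF c']
      by (simp add: ind_O_route xy)
  qed
  finally show ?thesis .
qed

section \<open>The invariants as index sums\<close>

lemma J_O_index_sum: "J_O n D = index_sum (\<lambda>a b. if a = n \<and> b \<noteq> 0 then 1 else 0) D"
  if "virtual_link_diagram D"
  unfolding J_O_def index_sum_def
  using sum.inter_filter[OF finite_SelfX[OF that], of "crossing_sign D" "\<lambda>c. ind_O D c = n \<and> ind_U D c \<noteq> 0"]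
  by (auto intro!: sum.cong)

lemma J_U_index_sum: "J_U n D = index_sum (\<lambda>a b. if b = n \<and> a \<noteq> 0 then 1 else 0) D"
  if "virtual_link_diagram D"
  unfolding J_U_def index_sum_def
  using sum.inter_filter[OF finite_SelfX[OF that], of "crossing_sign D" "\<lambda>c. ind_U D c = n \<and> ind_O D c \<noteq> 0"]
  by (auto intro!: sum.cong)

lemma P_O_index_sum: "P_O D = index_sum (\<lambda>a b. if b \<noteq> 0 then t_pow a - 1 else 0) D"
  if "virtual_link_diagram D"
  unfolding P_O_def index_sum_def sum.inter_filter[OF finite_SelfX[OF that]]
  by (auto intro!: sum.cong)

lemma P_U_index_sum: "P_U D = index_sum (\<lambda>a b. if a \<noteq> 0 then t_pow b - 1 else 0) D"
  if "virtual_link_diagram D"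
  unfolding P_U_def index_sum_def sum.inter_filter[OF finite_SelfX[OF that]]
  by (auto intro!: sum.cong)

lemma P_OU_index_sum: "P_OU D = index_sum (\<lambda>a b. (s_pow2 a - 1) * (t_pow2 b - 1)) D"
  unfolding P_OU_def index_sum_def by (simp add: mult.assoc)

lemma t_pow_0: "t_pow 0 = 1" "s_pow2 0 = 1" "t_pow2 0 = 1"
  by (simp_all add: t_pow_def s_pow2_def t_pow2_def flip: zero_prod_def)

section \<open>Tangents of periodic curves\<close>

lemma tangent_has_vector_derivative:
  assumes "virtual_link_diagram D" "i < ncomp D"
  shows "(curve D i has_vector_derivative tangent D (i, t)) (at t)"
  using immersed[OF assms]
  by (simp add: immersed_loop_def tangent_def C1_differentiable_on_eq flip: vector_derivative_works)

lemma tangent_eqI: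
  "(curve D (fst x) has_vector_derivative v) (at (snd x)) \<Longrightarrow> tangent D x = v"
  by (simp add: tangent_def vector_derivative_at)

lemma periodic_int:
  fixes g :: "real \<Rightarrow> 'a"
  assumes "\<And>t. g (t + 1) = g t"
  shows "g (t + of_int n) = g t"
proof -
  have nat: "g (t + of_nat k) = g t" for t k
  proof (induction k)
    case (Suc k)
    have "t + of_nat (Suc k) = (t + of_nat k) + 1" by simp
    then show ?case using assms[of "t + of_nat k"] Suc by (simp only:)
  qed simp
  show ?thesis
  proof (cases "n \<ge> 0")
    case True
    then show ?thesis using nat[of t "nat n"] by simp
  next
    case False
    then show ?thesis using nat[of "t + of_int n" "nat (- n)"] by simp
  qed
qed

lemma vector_derivative_periodic:
  fixes g :: "real \<Rightarrow> plane"
  assumes per: "\<And>t. g (t + 1) = g t" and d: "(g has_vector_derivative v) (at t)"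
  shows "(g has_vector_derivative v) (at (t + of_int n))"
proof -
  have "((g \<circ> (\<lambda>s. s - of_int n)) has_vector_derivative (1 *\<^sub>R v)) (at (t + of_int n))"
    by (rule vector_diff_chain_at) (use d in \<open>auto intro!: derivative_eq_intros simp: has_vector_derivative_def has_derivative_def bounded_linear_ident\<close>)
  moreover have "g \<circ> (\<lambda>s. s - of_int n) = g"
    using periodic_int[of g _ "- n", OF per] by (auto simp: fun_eq_iff)
  ultimately show ?thesis by simp
qed

section \<open>Isotopy\<close>

lemma C1_diffeo_det_nonzero:
  assumes "C1_diffeo f f'"
  shows "cross2 (blinfun_apply (f' x) (1, 0)) (blinfun_apply (f' x) (0, 1)) \<noteq> 0"
proof (rule det_nonzero_if_inj)
  show "linear (blinfun_apply (f' x))"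
    by (rule bounded_linear.linear) (rule blinfun.bounded_linear_right)
  show "inj (blinfun_apply (f' x))" using assms by (simp add: C1_diffeo_def bij_def)
qed

lemma continuous_on_det:
  fixes A :: "'a::topological_space \<Rightarrow> plane \<Rightarrow>\<^sub>L plane"
  assumes "continuous_on S A"
  shows "continuous_on S (\<lambda>x. cross2 (blinfun_apply (A x) (1, 0)) (blinfun_apply (A x) (0, 1)))"
  unfolding cross2_def by (intro continuous_intros assms)

lemma rsign_constant:
  fixes f :: "'a::topological_space \<Rightarrow> real"
  assumes "connected S" "continuous_on S f" "\<And>x. x \<in> S \<Longrightarrow> f x \<noteq> 0" "x \<in> S" "y \<in> S"
  shows "rsign (f x) = rsign (f y)"
proof -
  have c: "connected (f ` S)" using assms by (simp add: connected_continuous_image)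
  have z: "0 \<notin> f ` S" using assms(3) by force
  have "\<not> (f x > 0 \<and> f y < 0)" "\<not> (f y > 0 \<and> f x < 0)"
    using connectedD_interval[OF c, of "f y" "f x" 0] connectedD_interval[OF c, of "f x" "f y" 0] assms(4,5) z
    by (meson imageI less_imp_le)+
  then show ?thesis using assms(3)[OF assms(4)] assms(3)[OF assms(5)]
    by (auto simp: rsign_def not_less less_le)
qed

text \<open>
  Whether a diffeomorphism keeps or reverses all crossing signs is decided by the sign of its
  Jacobian determinant.
\<close>
lemma rsign_cross2_blinfun:
  assumes "C1_diffeo f f'" "cross2 u v \<noteq> 0"
  shows "rsign (cross2 (blinfun_apply (f' x) u) (blinfun_apply (f' x) v))
    = rsign (cross2 (blinfun_apply (f' x) (1, 0)) (blinfun_apply (f' x) (0, 1))) * rsign (cross2 u v)"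
proof -
  have lin: "linear (blinfun_apply (f' x))"
    by (rule bounded_linear.linear) (rule blinfun.bounded_linear_right)
  show ?thesis
    unfolding cross2_linear_image[OF lin, of u v]
    by (rule rsign_mult[OF C1_diffeo_det_nonzero[OF assms(1)] assms(2)])
qed

text \<open>
  Along the isotopy the Jacobian determinant at a fixed point is continuous in time, equals 1 at
  time 0 and has no zero, so the final map preserves frame orientations.
\<close>
lemma index_sum_isotopic:
  assumes D: "virtual_link_diagram D" and E: "virtual_link_diagram E" and iso: "isotopic D E"
  shows "index_sum F D = index_sum F E"
proof -
  obtain H H' where C1: "\<And>u. u \<in> {0..1::real} \<Longrightarrow> C1_diffeo (H u) (H' u)"
    and cH': "continuous_on ({0..1} \<times> UNIV) (\<lambda>(u, x). H' u x)"
    and H0: "H 0 = id" and nc: "ncomp E = ncomp D"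
    and cur: "\<And>i t. i < ncomp D \<Longrightarrow> curve E i t = H 1 (curve D i t)"
    and over: "over E = over D"
    using iso unfolding isotopic_def by blast
  have p: "passages E = passages D" by (simp add: passages_def nc)
  have bijH: "bij (H 1)" using C1[of 1] by (simp add: C1_diffeo_def)
  have pt: "point E x = H 1 (point D x)" if "x \<in> passages D" for x
    using cur that by (auto simp: point_def passages_def)
  have m: "meet D x y \<longleftrightarrow> meet E x y" for x y
    unfolding meet_def p using pt bijH by (metis bij_def inj_eq)
  define det where "det u x = cross2 (blinfun_apply (H' u x) (1, 0)) (blinfun_apply (H' u x) (0, 1))" for u x
  \<comment> \<open>The isotopy starts at the identity, and derivatives are unique.\<close>
  have "H' 0 x = id_blinfun" for x
  proof -
    have "(H 0 has_derivative blinfun_apply (H' 0 x)) (at x)" using C1[of 0] by (simp add: C1_diffeo_def)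
    moreover have "(H 0 has_derivative (\<lambda>h. h)) (at x)"
      unfolding H0 id_def by (rule has_derivative_ident)
    ultimately have "blinfun_apply (H' 0 x) = (\<lambda>h. h)" by (rule has_derivative_unique)
    then show ?thesis by (intro blinfun_eqI) simp
  qed
  then have det0: "det 0 x = 1" for x by (simp add: det_def cross2_def)
  have det1: "rsign (det 1 x) = 1" for x
  proof -
    have "continuous_on {0..1} (\<lambda>u. H' u x)"
      using continuous_on_compose2[OF cH', of "{0..1}" "\<lambda>u. (u, x)"] by (simp add: continuous_on_Pair image_subset_iff)
    then have "continuous_on {0..1} (\<lambda>u. det u x)"
      unfolding det_def by (rule continuous_on_det)
    then have "rsign (det 1 x) = rsign (det 0 x)"
      by (rule rsign_constant[rotated]) (simp_all add: det_def C1_diffeo_det_nonzero[OF C1])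
    then show ?thesis by (simp add: det0 rsign_def)
  qed
  have tan: "tangent E x = blinfun_apply (H' 1 (point D x)) (tangent D x)" if "x \<in> passages D" for x
  proof (rule tangent_eqI)
    obtain i t where x: "x = (i, t)" by (cases x)
    have i: "i < ncomp D" using that x by (simp add: passages_def)
    have "curve E i = H 1 \<circ> curve D i" using cur[OF i] by auto
    moreover have "((H 1 \<circ> curve D i) has_vector_derivative blinfun_apply (H' 1 (curve D i t)) (tangent D (i, t))) (at t)"
      by (rule vector_derivative_diff_chain_within[of _ _ _ UNIV, simplified])
        (use C1[of 1] tangent_has_vector_derivative[OF D i, of t] in \<open>auto simp: C1_diffeo_def intro: has_derivative_at_withinI\<close>)
    ultimately show "(curve E (fst x) has_vector_derivative blinfun_apply (H' 1 (point D x)) (tangent D x)) (at (snd x))"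
      by (simp add: x point_def)
  qed
  show ?thesis
  proof (rule index_sum_passage_bijection[OF D E, where b = "\<lambda>x. x"])
    fix x y assume xy: "meet E x y"
    then have "meet D x y" by (simp add: m)
    then have "x \<in> passages D" "y \<in> passages D" "point D x = point D y"
      "cross2 (tangent D x) (tangent D y) \<noteq> 0"
      using transverse[OF D] by (simp_all add: meet_def)
    then show "rsign (cross2 (tangent D x) (tangent D y)) = rsign (cross2 (tangent E x) (tangent E y))"
      using det1[of "point D y"] by (simp add: tan rsign_cross2_blinfun[OF C1[of 1]] det_def)
  qed (simp_all add: p m over bij_betw_def)
qed

section \<open>Change of parameter\<close>

lemma circle_reparam_facts:
  assumes "circle_reparam \<rho>"
  shows "(\<rho> has_real_derivative deriv \<rho> t) (at t)" and "deriv \<rho> t > 0"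
    and "strict_mono \<rho>" and "continuous_on S \<rho>" and "\<rho> (t + 1) = \<rho> t + 1"
proof -
  have d: "(\<rho> has_real_derivative deriv \<rho> t) (at t)" for t
    using assms
    by (simp add: circle_reparam_def C1_differentiable_on_eq DERIV_deriv_iff_real_differentiable)
  then show "(\<rho> has_real_derivative deriv \<rho> t) (at t)" .
  show "deriv \<rho> t > 0" "\<rho> (t + 1) = \<rho> t + 1" using assms by (auto simp: circle_reparam_def)
  show "strict_mono \<rho>"
  proof (rule strict_monoI)
    fix s t :: real assume "s < t"
    then show "\<rho> s < \<rho> t"
    proof (rule DERIV_pos_imp_increasing)
      fix u
      have "deriv \<rho> u > 0" using assms by (simp add: circle_reparam_def)
      with d[of u] show "\<exists>y. (\<rho> has_real_derivative y) (at u) \<and> y > 0" by blast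
    qed
  qed
  show "continuous_on S \<rho>"
    by (intro continuous_at_imp_continuous_on ballI DERIV_isCont[OF d])
qed

lemma circle_reparam_bij:
  assumes "circle_reparam \<rho>"
  shows "bij_betw (\<lambda>t. frac (\<rho> t)) {0..<1} {0..<1}"
  unfolding bij_betw_def
proof
  note f = circle_reparam_facts[OF assms]
  have lt: "\<rho> s < \<rho> 0 + 1" "\<rho> 0 \<le> \<rho> s" if "0 \<le> s" "s < 1" for s
    using that f(5)[of 0] strict_mono_less[OF f(3), of s 1] strict_mono_less_eq[OF f(3), of 0 s] by auto
  show "inj_on (\<lambda>t. frac (\<rho> t)) {0..<1}"
  proof (rule inj_onI)
    fix s t :: real assume st: "s \<in> {0..<1}" "t \<in> {0..<1}" "frac (\<rho> s) = frac (\<rho> t)"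
    define k where "k = \<lfloor>\<rho> s\<rfloor> - \<lfloor>\<rho> t\<rfloor>"
    have k: "\<rho> s - \<rho> t = of_int k" using st(3) by (simp add: frac_def k_def)
    moreover have "\<bar>\<rho> s - \<rho> t\<bar> < 1" using lt[of s] lt[of t] st by auto
    ultimately have "k = 0" by linarith
    with k have "\<rho> s = \<rho> t" by simp
    then show "s = t" using f(3) by (simp add: strict_mono_eq)
  qed
  show "(\<lambda>t. frac (\<rho> t)) ` {0..<1} = {0..<1}"
  proof (intro set_eqI iffI)
    fix v :: real assume v: "v \<in> {0..<1}"
    \<comment> \<open>The representative of \<open>v\<close> modulo 1 in the period \<open>[\<rho> 0, \<rho> 1)\<close>, where the intermediate value theorem applies.\<close>
    define w where "w = v + of_int \<lceil>\<rho> 0 - v\<rceil>"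
    have w: "\<rho> 0 \<le> w" "w < \<rho> 0 + 1" unfolding w_def by linarith+
    then obtain t where t: "0 \<le> t" "t \<le> 1" "\<rho> t = w"
      using IVT'[of \<rho> 0 w 1] f(4) f(5)[of 0] by auto
    have "t \<noteq> 1" using t w f(5)[of 0] by auto
    then have "t \<in> {0..<1}" using t by simp
    moreover have "frac (\<rho> t) = v" using v t by (simp add: w_def frac_def) linarith
    ultimately show "v \<in> (\<lambda>t. frac (\<rho> t)) ` {0..<1}"
      using image_eqI[of v "\<lambda>t. frac (\<rho> t)" t] by simp
  qed (auto simp: frac_lt_1)
qed

text \<open>
  Modulo 1 the lift \<open>\<rho>\<close> wraps around at most once on \<open>{0..<1}\<close>; which points have wrapped
  is monotone in the parameter, so the cyclic order survives.
\<close>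
lemma circle_reparam_open_arc:
  assumes "circle_reparam \<rho>" and s: "s \<in> {0..<1}" and t: "t \<in> {0..<1}" and u: "u \<in> {0..<1}"
  shows "frac (\<rho> u) \<in> open_arc (frac (\<rho> s)) (frac (\<rho> t)) \<longleftrightarrow> u \<in> open_arc s t"
proof -
  note f = circle_reparam_facts[OF assms(1)]
  define n where "n = \<lfloor>\<rho> 0\<rfloor>"
  have fr: "frac (\<rho> s) = (if \<rho> s < n + 1 then \<rho> s - n else \<rho> s - n - 1)"
    and lt: "\<rho> s < \<rho> 0 + 1" "\<rho> 0 \<le> \<rho> s" if "s \<in> {0..<1}" for s
  proof -
    show lt: "\<rho> s < \<rho> 0 + 1" "\<rho> 0 \<le> \<rho> s"
      using that f(5)[of 0] strict_mono_less[OF f(3), of s 1] strict_mono_less_eq[OF f(3), of 0 s] by auto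
    have "\<lfloor>\<rho> s\<rfloor> = (if \<rho> s < n + 1 then n else n + 1)"
      using lt unfolding n_def by (auto simp: floor_eq_iff) linarith+
    then show "frac (\<rho> s) = (if \<rho> s < n + 1 then \<rho> s - n else \<rho> s - n - 1)"
      by (simp add: frac_def)
  qed
  have n: "n \<le> \<rho> 0" unfolding n_def by linarith
  have ord: "s < u \<longleftrightarrow> \<rho> s < \<rho> u" "u < t \<longleftrightarrow> \<rho> u < \<rho> t" "s < t \<longleftrightarrow> \<rho> s < \<rho> t"
    using f(3) by (simp_all add: strict_mono_less)
  have "frac (\<rho> u) \<in> {0..<1}" by (simp add: frac_lt_1)
  then show ?thesis
    unfolding open_arc_def mem_Collect_eq ord
    using fr[OF s] fr[OF t] fr[OF u] lt[OF s] lt[OF t] lt[OF u] n u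
    by (simp split: if_splits)
qed

lemma index_sum_same_loops:
  assumes D: "virtual_link_diagram D" and E: "virtual_link_diagram E" and same: "same_loops D E"
  shows "index_sum F D = index_sum F E"
proof -
  obtain \<sigma> \<rho> where nc: "ncomp E = ncomp D" and \<sigma>: "bij_betw \<sigma> {..<ncomp D} {..<ncomp D}"
    and \<rho>: "\<And>i. i < ncomp D \<Longrightarrow> circle_reparam (\<rho> i)"
    and cur: "\<And>i t. i < ncomp D \<Longrightarrow> curve E i t = curve D (\<sigma> i) (\<rho> i t)"
    and over: "over E = {(i, t). (i, t) \<in> passages E \<and> (\<sigma> i, frac (\<rho> i t)) \<in> over D}"
    using same unfolding same_loops_def by blast
  define b where "b x = (\<sigma> (fst x), frac (\<rho> (fst x) (snd x)))" for x
  have p: "x \<in> passages E \<longleftrightarrow> fst x < ncomp D \<and> snd x \<in> {0..<1}" for x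
    by (auto simp: passages_def nc mem_Times_iff)
  have pD: "x \<in> passages D \<longleftrightarrow> fst x < ncomp D \<and> snd x \<in> {0..<1}" for x
    by (auto simp: passages_def mem_Times_iff)
  have \<sigma>1: "\<sigma> i < ncomp D" if "i < ncomp D" for i
    using \<sigma> that by (auto simp: bij_betw_def)
  have \<sigma>2: "\<sigma> i = \<sigma> j \<longleftrightarrow> i = j" if "i < ncomp D" "j < ncomp D" for i j
    using \<sigma> that by (auto simp: bij_betw_def inj_on_def)
  have inj: "x = y" if "x \<in> passages E" "y \<in> passages E" "b x = b y" for x y
    using that \<sigma>2[of "fst x" "fst y"] circle_reparam_bij[OF \<rho>[of "fst x"]]
    by (auto simp: p b_def bij_betw_def prod_eq_iff inj_on_def)
  have bp: "b x \<in> passages D" if "x \<in> passages E" for x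
    using that by (auto simp: p pD b_def \<sigma>1 frac_lt_1)
  have bij: "bij_betw b (passages E) (passages D)"
    unfolding bij_betw_def
  proof
    show "inj_on b (passages E)" using inj by (rule inj_onI)
    show "b ` passages E = passages D"
    proof (intro set_eqI iffI)
      fix y assume y: "y \<in> passages D"
      have "fst y \<in> \<sigma> ` {..<ncomp D}" using y \<sigma> by (simp add: pD bij_betw_def)
      then obtain i where i: "i < ncomp D" "\<sigma> i = fst y" by auto
      have "snd y \<in> (\<lambda>t. frac (\<rho> i t)) ` {0..<1}"
        using y circle_reparam_bij[OF \<rho>[OF i(1)]] by (simp add: pD bij_betw_def)
      then obtain t where "t \<in> {0..<1}" "frac (\<rho> i t) = snd y" by auto
      then have "b (i, t) = y" "(i, t) \<in> passages E" using i by (auto simp: b_def p prod_eq_iff)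
      then show "y \<in> b ` passages E" by blast
    qed (use bp in auto)
  qed
  have per: "curve D i (t + 1) = curve D i t" if "i < ncomp D" for i t
    using immersed[OF D that] by (simp add: immersed_loop_def)
  have fracint: "\<rho> i t = frac (\<rho> i t) + of_int \<lfloor>\<rho> i t\<rfloor>" for i t
    by (simp add: frac_def)
  have pt: "point E x = point D (b x)" if "x \<in> passages E" for x
  proof -
    have i: "fst x < ncomp D" using that by (simp add: p)
    have "curve D (\<sigma> (fst x)) (frac (\<rho> (fst x) (snd x)) + of_int \<lfloor>\<rho> (fst x) (snd x)\<rfloor>)
        = curve D (\<sigma> (fst x)) (frac (\<rho> (fst x) (snd x)))"
      by (rule periodic_int) (rule per[OF \<sigma>1[OF i]])
    then show ?thesis
      by (simp add: i point_def cur b_def flip: fracint)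
  qed
  have tan: "tangent E x = deriv (\<rho> (fst x)) (snd x) *\<^sub>R tangent D (b x)" if "x \<in> passages E" for x
  proof (rule tangent_eqI)
    obtain i t where x: "x = (i, t)" by (cases x)
    have i: "i < ncomp D" using that by (simp add: p x)
    have "(curve D (\<sigma> i) has_vector_derivative tangent D (\<sigma> i, frac (\<rho> i t))) (at (\<rho> i t))"
      using vector_derivative_periodic[of "curve D (\<sigma> i)", OF per[OF \<sigma>1[OF i]]
          tangent_has_vector_derivative[OF D \<sigma>1[OF i]], of "frac (\<rho> i t)" "\<lfloor>\<rho> i t\<rfloor>"]
      by (simp flip: fracint)
    moreover have "(\<rho> i has_vector_derivative deriv (\<rho> i) t) (at t)"
      using circle_reparam_facts(1)[OF \<rho>[OF i]] by (simp add: has_real_derivative_iff_has_vector_derivative)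
    ultimately have "((curve D (\<sigma> i) \<circ> \<rho> i) has_vector_derivative deriv (\<rho> i) t *\<^sub>R tangent D (\<sigma> i, frac (\<rho> i t))) (at t)"
      by (rule vector_diff_chain_at[rotated])
    moreover have "curve D (\<sigma> i) \<circ> \<rho> i = curve E i" using cur[OF i] by auto
    ultimately show "(curve E (fst x) has_vector_derivative deriv (\<rho> (fst x)) (snd x) *\<^sub>R tangent D (b x)) (at (snd x))"
      by (simp add: x b_def)
  qed
  have m: "meet D (b x) (b y) \<longleftrightarrow> meet E x y" if "x \<in> passages E" "y \<in> passages E" for x y
    unfolding meet_def using that bp pt inj by metis
  show ?thesis
  proof (rule index_sum_passage_bijection[OF D E bij m])
    fix x assume "x \<in> passages E"
    then show "b x \<in> over D \<longleftrightarrow> x \<in> over E" by (cases x) (simp add: over b_def)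
  next
    fix x y assume xy: "meet E x y"
    then have px: "x \<in> passages E" "y \<in> passages E" by (simp_all add: meet_def)
    then have "deriv (\<rho> (fst x)) (snd x) * deriv (\<rho> (fst y)) (snd y) > 0"
      using circle_reparam_facts(2)[OF \<rho>] by (auto simp: p)
    then show "rsign (cross2 (tangent D (b x)) (tangent D (b y))) = rsign (cross2 (tangent E x) (tangent E y))"
      by (simp add: tan px cross2_scaleR rsign_mult_pos)
  next
    fix x y assume "x \<in> passages E" "y \<in> passages E"
    then show "fst (b x) = fst (b y) \<longleftrightarrow> fst x = fst y" by (simp add: b_def p \<sigma>2)
  next
    fix x y z assume *: "x \<in> passages E" "y \<in> passages E" "z \<in> passages E" "fst x = fst y"
    show "b z \<in> route (b x) (b y) \<longleftrightarrow> z \<in> route x y"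
    proof (cases "fst z = fst x")
      case True
      then show ?thesis
        using * circle_reparam_open_arc[OF \<rho>, of "fst z" "snd x" "snd y" "snd z"]
        by (simp add: route_def b_def p mem_Times_iff)
    next
      case False
      then show ?thesis using * by (auto simp: route_def b_def p mem_Times_iff \<sigma>2)
    qed
  qed auto
qed

section \<open>Strands of a local move\<close>

text \<open>
  The parameter stretches occupied by the strands of a local move, without the diagram. On one
  component they are disjoint closed intervals inside \<open>{0<..<1}\<close>, which makes the statements
  below about routes matters of the order of intervals.
\<close>
locale strands =
  fixes k :: nat and ix :: "nat \<Rightarrow> nat" and m r :: "nat \<Rightarrow> real"
  assumes r_nonzero: "j < k \<Longrightarrow> r j \<noteq> 0"
    and param_range: "j < k \<Longrightarrow> 0 < m j - \<bar>r j\<bar> \<and> m j + \<bar>r j\<bar> < 1"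
    and arcs_disjoint: "i < k \<Longrightarrow> j < k \<Longrightarrow> i \<noteq> j \<Longrightarrow>
      (\<lambda>s. (ix i, m i + r i * s)) ` {-1..1} \<inter> (\<lambda>s. (ix j, m j + r j * s)) ` {-1..1} = {}"
begin

definition pos :: "nat \<Rightarrow> real \<Rightarrow> nat \<times> real" where
  "pos j s = (ix j, m j + r j * s)"

definition inside :: "(nat \<times> real) set" where
  "inside = (\<Union>j<k. pos j ` {-1..1})"

lemma fst_pos [simp]: "fst (pos j s) = ix j"
  by (simp add: pos_def)

lemma pos_inside: "j < k \<Longrightarrow> s \<in> {-1..1} \<Longrightarrow> pos j s \<in> inside"
  unfolding inside_def by blast

lemma insideE:
  assumes "x \<in> inside"
  obtains j s where "j < k" "s \<in> {-1..1}" "x = pos j s"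
  using assms by (auto simp: inside_def)

lemma pos_eq_iff:
  assumes "i < k" "j < k" "s \<in> {-1..1}" "t \<in> {-1..1}"
  shows "pos i s = pos j t \<longleftrightarrow> i = j \<and> s = t"
proof
  assume eq: "pos i s = pos j t"
  have "pos j u \<in> (\<lambda>s. (ix j, m j + r j * s)) ` {-1..1}" if "u \<in> {-1..1}" for j u
    by (rule image_eqI[OF _ that]) (simp add: pos_def)
  from this[OF assms(3), of i] this[OF assms(4), of j]
  have "i = j" using arcs_disjoint[OF assms(1,2)] unfolding eq by blast
  then show "i = j \<and> s = t" using eq r_nonzero[OF assms(1)] by (simp add: pos_def)
qed simp

lemma snd_pos_range:
  assumes "s \<in> {-1..1}"
  shows "m j - \<bar>r j\<bar> \<le> snd (pos j s)" "snd (pos j s) \<le> m j + \<bar>r j\<bar>"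
proof -
  have "\<bar>r j * s\<bar> \<le> \<bar>r j\<bar> * 1" unfolding abs_mult by (rule mult_left_mono) (use assms in auto)
  then show "m j - \<bar>r j\<bar> \<le> snd (pos j s)" "snd (pos j s) \<le> m j + \<bar>r j\<bar>"
    by (auto simp: pos_def)
qed

lemma inside_interval:
  assumes "j < k" "fst x = ix j" "m j - \<bar>r j\<bar> \<le> snd x" "snd x \<le> m j + \<bar>r j\<bar>"
  obtains s where "s \<in> {-1..1}" "x = pos j s"
proof
  have r: "r j \<noteq> 0" by (rule r_nonzero) fact
  have "\<bar>snd x - m j\<bar> \<le> \<bar>r j\<bar>" using assms by auto
  then have "\<bar>(snd x - m j) / r j\<bar> \<le> 1" using r by (simp add: abs_divide)
  then show "(snd x - m j) / r j \<in> {-1..1}"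
    unfolding abs_le_iff atLeastAtMost_iff by linarith
  show "x = pos j ((snd x - m j) / r j)"
    using r assms(2) by (simp add: pos_def prod_eq_iff)
qed

lemma outside_interval:
  assumes "j < k" "fst x = ix j" "x \<notin> inside"
  shows "snd x < m j - \<bar>r j\<bar> \<or> m j + \<bar>r j\<bar> < snd x"
  by (rule ccontr) (use assms inside_interval[of j x] pos_inside in \<open>auto simp: not_less\<close>)

lemma intervals_disjoint:
  assumes "i < k" "j < k" "i \<noteq> j" "ix i = ix j"
  shows "m i + \<bar>r i\<bar> < m j - \<bar>r j\<bar> \<or> m j + \<bar>r j\<bar> < m i - \<bar>r i\<bar>"
proof (rule ccontr)
  assume *: "\<not> ?thesis"
  define u where "u = max (m i - \<bar>r i\<bar>) (m j - \<bar>r j\<bar>)"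
  obtain s where s: "s \<in> {-1..1}" "(ix i, u) = pos i s"
    by (rule inside_interval[of i "(ix i, u)"]) (use assms * in \<open>auto simp: u_def\<close>)
  obtain t where t: "t \<in> {-1..1}" "(ix i, u) = pos j t"
    by (rule inside_interval[of j "(ix i, u)"]) (use assms * in \<open>auto simp: u_def\<close>)
  show False using pos_eq_iff[of i j s t] assms s t by simp
qed

text \<open>
  The bounds 0 and 1 in \<^const>\<open>open_arc\<close> are automatic on a strand; what remains are comparisons
  with the two ends of the route.
\<close>
lemma mem_route_pos:
  assumes "j < k" "u \<in> {-1..1}" "ix j = fst x"
  shows "pos j u \<in> route x y \<longleftrightarrow> (if snd x < snd y then snd x < snd (pos j u) \<and> snd (pos j u) < snd y
    else snd x < snd (pos j u) \<or> snd (pos j u) < snd y)"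
  using snd_pos_range[OF assms(2), of j] param_range[OF assms(1)] assms(3)
  by (simp add: route_def open_arc_def mem_Times_iff)

text \<open>
  A route that begins and ends off the strands contains each strand wholly or not at all.
\<close>
lemma pos_route_outside:
  assumes xy: "x \<notin> inside" "y \<notin> inside" "fst x = fst y" and j: "j < k"
    and st: "s \<in> {-1..1}" "t \<in> {-1..1}"
  shows "pos j s \<in> route x y \<longleftrightarrow> pos j t \<in> route x y"
proof (cases "fst x = ix j")
  case True
  have "snd x < snd (pos j s) \<longleftrightarrow> snd x < snd (pos j t)"
    using outside_interval[OF j True xy(1)] snd_pos_range[OF st(1), of j] snd_pos_range[OF st(2), of j]
    by linarith
  moreover have "snd (pos j s) < snd y \<longleftrightarrow> snd (pos j t) < snd y"
    using outside_interval[OF j _ xy(2)] True xy(3)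
      snd_pos_range[OF st(1), of j] snd_pos_range[OF st(2), of j] by simp linarith
  ultimately show ?thesis using j st True by (simp add: mem_route_pos)
qed (simp add: route_def mem_Times_iff)

context
  fixes p q :: nat
  assumes pq: "p < k" "q < k" "p \<noteq> q" "ix p = ix q"
begin

text \<open>
  Distinct strands on one component are ordered as a whole, by their midpoints.
\<close>
lemma pos_less_pos:
  assumes "s \<in> {-1..1}" "t \<in> {-1..1}"
  shows "snd (pos p s) < snd (pos q t) \<longleftrightarrow> m p < m q"
  using intervals_disjoint[OF pq] snd_pos_range[OF assms(1), of p] snd_pos_range[OF assms(2), of q]
    param_range[OF pq(1)] param_range[OF pq(2)] by linarith

end

context
  fixes p q :: nat
  assumes pq: "p < k" "q < k" "p \<noteq> q" "ix p = ix q"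
begin

lemma route_pos_outside:
  assumes z: "z \<notin> inside" and st: "s \<in> {-1..1}" "t \<in> {-1..1}" "s' \<in> {-1..1}" "t' \<in> {-1..1}"
  shows "z \<in> route (pos p s) (pos q t) \<longleftrightarrow> z \<in> route (pos p s') (pos q t')"
proof (cases "fst z = ix p")
  case True
  have "snd (pos p s) < snd z \<longleftrightarrow> snd (pos p s') < snd z"
    using outside_interval[OF pq(1) True z] snd_pos_range[OF st(1), of p] snd_pos_range[OF st(3), of p]
    by linarith
  moreover have "snd z < snd (pos q t) \<longleftrightarrow> snd z < snd (pos q t')"
    using outside_interval[OF pq(2) _ z] True pq(4)
      snd_pos_range[OF st(2), of q] snd_pos_range[OF st(4), of q] by simp linarith
  ultimately show ?thesis
    using pos_less_pos[OF pq] st by (simp add: route_def open_arc_def mem_Times_iff)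
qed (simp add: route_def mem_Times_iff)

lemma route_pos_other_strand:
  assumes j: "j < k" "j \<noteq> p" "j \<noteq> q" and u: "u \<in> {-1..1}" "u' \<in> {-1..1}"
    and st: "s \<in> {-1..1}" "t \<in> {-1..1}" "s' \<in> {-1..1}" "t' \<in> {-1..1}"
  shows "pos j u \<in> route (pos p s) (pos q t) \<longleftrightarrow> pos j u' \<in> route (pos p s') (pos q t')"
proof (cases "ix j = ix p")
  case True
  then show ?thesis
    using j u st pq pos_less_pos[OF pq] pos_less_pos[of p j] pos_less_pos[of j q]
    by (simp add: mem_route_pos)
qed (simp add: route_def mem_Times_iff)

lemma route_pos_first_strand:
  assumes "u \<in> {-1..1}" "s \<in> {-1..1}" "t \<in> {-1..1}"
  shows "pos p u \<in> route (pos p s) (pos q t) \<longleftrightarrow> r p * (u - s) > 0"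
proof -
  have "snd (pos p s) < snd (pos p u) \<longleftrightarrow> r p * (u - s) > 0" by (simp add: pos_def algebra_simps)
  then show ?thesis
    using assms pq pos_less_pos[OF pq] by (simp add: mem_route_pos)
qed

lemma route_pos_last_strand:
  assumes "u \<in> {-1..1}" "s \<in> {-1..1}" "t \<in> {-1..1}"
  shows "pos q u \<in> route (pos p s) (pos q t) \<longleftrightarrow> r q * (u - t) < 0"
proof -
  have "snd (pos q u) < snd (pos q t) \<longleftrightarrow> r q * (u - t) < 0" by (simp add: pos_def algebra_simps)
  then show ?thesis
    using assms pq pos_less_pos[OF pq] by (simp add: mem_route_pos)
qed

end

end

section \<open>A tangle in a diagram\<close>

definition crossing_params :: "real set" where
  "crossing_params = {- 1 / 2, 0, 1 / 2}"

lemma sum_crossing_params: "sum g crossing_params = g (- 1 / 2) + g 0 + g (1 / 2)"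
  by (simp add: crossing_params_def add.assoc)

lemma crossing_params_range: "s \<in> crossing_params \<Longrightarrow> s \<in> {-1..1}"
  and crossing_params_interior: "s \<in> crossing_params \<Longrightarrow> \<bar>s\<bar> < 1"
  by (auto simp: crossing_params_def)

text \<open>
  What is needed of the picture of a tangle: it stays in the square, so that inside and
  outside do not meet, and its classical crossings occur at the three special parameters.
\<close>
definition box_tangle :: "nat \<Rightarrow> tangle \<Rightarrow> (nat \<times> real) set \<Rightarrow> bool" where
  "box_tangle k T W \<longleftrightarrow>
     (\<forall>j<k. \<forall>s\<in>{-1..1}. T j s \<in> box2) \<and>
     (\<forall>i<k. \<forall>j<k. \<forall>s\<in>{-1..1}. \<forall>t\<in>{-1..1}.
        (i, s) \<noteq> (j, t) \<and> T i s = T j t \<and> (i, s) \<in> W \<longrightarrow> s \<in> crossing_params \<and> t \<in> crossing_params)"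

text \<open>
  One side of a local move.
\<close>
locale tangle_in_diagram = strands k ix m r
  for k ix m r +
  fixes D :: diagram and T :: tangle and W :: "(nat \<times> real) set"
    and \<phi> :: "plane \<Rightarrow> plane" and \<phi>' :: "plane \<Rightarrow> plane \<Rightarrow>\<^sub>L plane"
  assumes diagram: "virtual_link_diagram D"
    and tangle: "box_tangle k T W"
    and chart: "C1_diffeo \<phi> \<phi>'"
    and comp: "j < k \<Longrightarrow> ix j < ncomp D"
    and point_outside: "x \<in> passages D \<Longrightarrow> x \<notin> inside \<Longrightarrow> point D x \<notin> \<phi> ` box2"
    and point_pos: "j < k \<Longrightarrow> s \<in> {-1..1} \<Longrightarrow> point D (pos j s) = \<phi> (T j s)"
    and over_pos: "j < k \<Longrightarrow> s \<in> {-1..1} \<Longrightarrow> pos j s \<in> over D \<longleftrightarrow> (j, s) \<in> W"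
begin

lemma inj_chart: "inj \<phi>"
  using chart by (simp add: C1_diffeo_def bij_def)

lemma pos_passage: "j < k \<Longrightarrow> s \<in> {-1..1} \<Longrightarrow> pos j s \<in> passages D"
  using snd_pos_range[of s j] param_range[of j] comp[of j]
  by (simp add: passages_def mem_Times_iff)

lemma meet_pos_iff:
  assumes "i < k" "j < k" "s \<in> {-1..1}" "t \<in> {-1..1}"
  shows "meet D (pos i s) (pos j t) \<longleftrightarrow> (i, s) \<noteq> (j, t) \<and> T i s = T j t"
  using assms by (simp add: meet_def pos_passage point_pos pos_eq_iff inj_eq[OF inj_chart])

text \<open>
  A point in the image of the square is met by no passage outside.
\<close>
lemma meet_inside:
  assumes "meet D x y" "x \<in> inside"
  shows "y \<in> inside"
proof (rule ccontr)
  assume y: "y \<notin> inside"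
  obtain j s where x: "j < k" "s \<in> {-1..1}" "x = pos j s"
    using assms(2) by (rule insideE)
  have "T j s \<in> box2" using tangle x by (simp add: box_tangle_def)
  then have "point D x \<in> \<phi> ` box2" using x by (simp add: point_pos)
  then show False using point_outside[OF _ y] assms(1) by (simp add: meet_def)
qed

lemma classical_passage_inside:
  assumes "x \<in> classical_passages D" "x \<in> inside"
  obtains j s where "j < k" "s \<in> crossing_params" "x = pos j s"
proof -
  obtain y where y: "meet D x y" "x \<in> over D \<or> y \<in> over D"
    using assms(1) by (auto simp: classical_passages_iff)
  obtain i s where x: "i < k" "s \<in> {-1..1}" "x = pos i s"
    using assms(2) by (rule insideE)
  obtain j t where y': "j < k" "t \<in> {-1..1}" "y = pos j t"
    using meet_inside[OF y(1) assms(2)] by (rule insideE)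
  have m: "(i, s) \<noteq> (j, t) \<and> T i s = T j t" "(j, t) \<noteq> (i, s) \<and> T j t = T i s"
    using y(1) x y' meet_pos_iff[of i j s t] by auto
  have "(i, s) \<in> W \<or> (j, t) \<in> W"
    using y(2) x y' over_pos by simp
  then have "s \<in> crossing_params"
    using tangle m x y' unfolding box_tangle_def by blast
  then show thesis using that x by blast
qed

text \<open>
  All classical passages on strands are among the \<open>k * 3\<close> special ones, where a special
  passage without classical crossing counts with weight 0.
\<close>
lemma route_index_inside_outside:
  "route_index D x y =
     (\<Sum>z \<in> classical_passages D - inside. if z \<in> route x y then weight D z else 0) +
     (\<Sum>j<k. \<Sum>s\<in>crossing_params. if pos j s \<in> route x y then weight D (pos j s) else 0)"
proof -
  let ?P = "(\<lambda>(j, s). pos j s) ` ({..<k} \<times> crossing_params)"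
  let ?g = "\<lambda>z. if z \<in> route x y then weight D z else 0"
  have fin: "finite (classical_passages D)" by (rule finite_classical_passages[OF diagram])
  have finP: "finite ?P" by (simp add: crossing_params_def)
  have "classical_passages D \<subseteq> (classical_passages D - inside) \<union> ?P"
  proof
    fix z assume z: "z \<in> classical_passages D"
    show "z \<in> (classical_passages D - inside) \<union> ?P"
    proof (cases "z \<in> inside")
      case True
      then obtain j s where "j < k" "s \<in> crossing_params" "z = pos j s"
        using classical_passage_inside[OF z] by blast
      then show ?thesis by (auto intro!: image_eqI[of _ _ "(j, s)"])
    qed (use z in simp)
  qed
  then have "route_index D x y = sum ?g ((classical_passages D - inside) \<union> ?P)"
    using fin finP by (intro route_index_weight[OF diagram]) simp_all
  also have "\<dots> = sum ?g (classical_passages D - inside) + sum ?g ?P"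
    by (rule sum.union_disjoint)
      (use fin finP crossing_params_range in \<open>auto intro!: pos_inside\<close>)
  also have "sum ?g ?P = (\<Sum>(j, s)\<in>{..<k} \<times> crossing_params. ?g (pos j s))"
  proof (subst sum.reindex)
    show "inj_on (\<lambda>(j, s). pos j s) ({..<k} \<times> crossing_params)"
      by (rule inj_onI) (use pos_eq_iff[OF _ _ crossing_params_range crossing_params_range] in auto)
  qed (simp add: case_prod_unfold)
  also have "\<dots> = (\<Sum>j<k. \<Sum>s\<in>crossing_params. ?g (pos j s))"
    by (rule sum.cartesian_product[symmetric])
  finally show ?thesis .
qed

definition strand_sum :: "nat \<Rightarrow> int" where
  "strand_sum j = (\<Sum>s\<in>crossing_params. weight D (pos j s))"

text \<open>
  The contribution of a strand to a route that starts on it (\<open>after\<close>) or ends on it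
  (\<open>before\<close>). The sign of \<open>r j\<close> decides which parameters come later on the component.
\<close>
definition after :: "nat \<Rightarrow> real \<Rightarrow> int" where
  "after j s = (\<Sum>u\<in>crossing_params. if r j * (u - s) > 0 then weight D (pos j u) else 0)"

definition before :: "nat \<Rightarrow> real \<Rightarrow> int" where
  "before j s = (\<Sum>u\<in>crossing_params. if r j * (u - s) < 0 then weight D (pos j u) else 0)"

lemma route_index_outside:
  assumes "x \<notin> inside" "y \<notin> inside" "fst x = fst y"
  shows "route_index D x y =
     (\<Sum>z \<in> classical_passages D - inside. if z \<in> route x y then weight D z else 0) +
     (\<Sum>j<k. if pos j 0 \<in> route x y then strand_sum j else 0)"
proof -
  have "(\<Sum>s\<in>crossing_params. if pos j s \<in> route x y then weight D (pos j s) else 0)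
      = (if pos j 0 \<in> route x y then strand_sum j else 0)" if "j < k" for j
  proof -
    have "pos j s \<in> route x y \<longleftrightarrow> pos j 0 \<in> route x y" if "s \<in> crossing_params" for s
      using pos_route_outside[OF assms \<open>j < k\<close> crossing_params_range[OF that], of 0] by simp
    then show ?thesis by (simp add: strand_sum_def cong: sum.cong)
  qed
  then show ?thesis unfolding route_index_inside_outside by simp
qed

text \<open>
  Moving the crossing along its two strands affects the index only through the last two
  terms; the first two do not depend on \<open>s\<close> and \<open>t\<close>.
\<close>
lemma route_index_between:
  assumes pq: "p < k" "q < k" "p \<noteq> q" "ix p = ix q"
    and s: "s \<in> {-1..1}" and t: "t \<in> {-1..1}"
  shows "route_index D (pos p s) (pos q t) =
     (\<Sum>z \<in> classical_passages D - inside. if z \<in> route (pos p 0) (pos q 0) then weight D z else 0) +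
     (\<Sum>j\<in>{..<k} - {p, q}. if pos j 0 \<in> route (pos p 0) (pos q 0) then strand_sum j else 0) +
     after p s + before q t"
proof -
  let ?R = "route (pos p s) (pos q t)" and ?Q = "route (pos p 0) (pos q 0)"
  let ?h = "\<lambda>j. \<Sum>u\<in>crossing_params. if pos j u \<in> ?R then weight D (pos j u) else 0"
  have out: "(\<Sum>z \<in> classical_passages D - inside. if z \<in> ?R then weight D z else 0)
    = (\<Sum>z \<in> classical_passages D - inside. if z \<in> ?Q then weight D z else 0)"
  proof (rule sum.cong[OF refl])
    fix z assume "z \<in> classical_passages D - inside"
    then show "(if z \<in> ?R then weight D z else 0) = (if z \<in> ?Q then weight D z else 0)"
      using route_pos_outside[OF pq, of z s t 0 0] s t by simp
  qed
  have other: "?h j = (if pos j 0 \<in> ?Q then strand_sum j else 0)" if "j \<in> {..<k} - {p, q}" for j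
  proof -
    have "pos j u \<in> ?R \<longleftrightarrow> pos j 0 \<in> ?Q" if u: "u \<in> crossing_params" for u
      by (rule route_pos_other_strand[OF pq])
        (use crossing_params_range[OF u] \<open>j \<in> _\<close> s t in auto)
    then show ?thesis by (simp add: strand_sum_def cong: sum.cong)
  qed
  have p: "?h p = after p s"
    unfolding after_def
  proof (rule sum.cong[OF refl])
    fix u assume u: "u \<in> crossing_params"
    show "(if pos p u \<in> ?R then weight D (pos p u) else 0)
        = (if r p * (u - s) > 0 then weight D (pos p u) else 0)"
      by (simp only: route_pos_first_strand[OF pq crossing_params_range[OF u] s t])
  qed
  have q: "?h q = before q t"
    unfolding before_def
  proof (rule sum.cong[OF refl])
    fix u assume u: "u \<in> crossing_params"
    show "(if pos q u \<in> ?R then weight D (pos q u) else 0)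
        = (if r q * (u - t) < 0 then weight D (pos q u) else 0)"
      by (simp only: route_pos_last_strand[OF pq crossing_params_range[OF u] s t])
  qed
  have "{..<k} = insert p (insert q ({..<k} - {p, q}))" using pq by auto
  then have "(\<Sum>j<k. ?h j) = (\<Sum>j\<in>insert p (insert q ({..<k} - {p, q})). ?h j)" by (rule arg_cong)
  also have "\<dots> = ?h p + ?h q + (\<Sum>j\<in>{..<k} - {p, q}. ?h j)"
    using pq by (simp add: add.assoc)
  also have "(\<Sum>j\<in>{..<k} - {p, q}. ?h j)
      = (\<Sum>j\<in>{..<k} - {p, q}. if pos j 0 \<in> ?Q then strand_sum j else 0)"
    by (rule sum.cong[OF refl]) (rule other)
  finally show ?thesis unfolding route_index_inside_outside out p q by simp
qed

text \<open>
  The sign of the Jacobian determinant of the chart, taken at the origin but equal at all points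
  because the plane is connected. It is common to both sides of a move.
\<close>
definition orientation :: int where
  "orientation = rsign (cross2 (blinfun_apply (\<phi>' 0) (1, 0)) (blinfun_apply (\<phi>' 0) (0, 1)))"

lemma rsign_cross2_chart:
  assumes "cross2 u v \<noteq> 0"
  shows "rsign (cross2 (blinfun_apply (\<phi>' x) u) (blinfun_apply (\<phi>' x) v)) = orientation * rsign (cross2 u v)"
proof -
  have "continuous_on UNIV \<phi>'" using chart by (simp add: C1_diffeo_def)
  then have "rsign (cross2 (blinfun_apply (\<phi>' x) (1, 0)) (blinfun_apply (\<phi>' x) (0, 1))) = orientation"
    unfolding orientation_def
    by (intro rsign_constant[OF connected_UNIV continuous_on_det]) (simp_all add: C1_diffeo_det_nonzero[OF chart])
  then show ?thesis by (simp add: rsign_cross2_blinfun[OF chart assms])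
qed

text \<open>
  The chain rule for the curve \<open>\<phi> \<circ> T j\<close> with the affine change of parameter of the strand.
\<close>
lemma tangent_pos:
  assumes j: "j < k" and s: "\<bar>s\<bar> < 1" and v: "(T j has_vector_derivative v) (at s)"
  shows "tangent D (pos j s) = inverse (r j) *\<^sub>R blinfun_apply (\<phi>' (T j s)) v"
proof (rule tangent_eqI)
  let ?f = "\<lambda>t. (t - m j) / r j"
  let ?t = "m j + r j * s"
  have r: "r j \<noteq> 0" using j by (rule r_nonzero)
  then have ft: "?f ?t = s" by simp
  have "(?f has_vector_derivative inverse (r j)) (at ?t)"
    using r by (auto intro!: derivative_eq_intros simp: field_simps simp flip: has_real_derivative_iff_has_vector_derivative)
  moreover have "(T j has_vector_derivative v) (at (?f ?t))" using v by (simp only: ft)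
  ultimately have "((T j \<circ> ?f) has_vector_derivative inverse (r j) *\<^sub>R v) (at ?t)"
    by (rule vector_diff_chain_at)
  moreover have "(\<phi> has_derivative blinfun_apply (\<phi>' (T j s))) (at ((T j \<circ> ?f) ?t))"
    using chart ft by (simp add: C1_diffeo_def)
  ultimately have "((\<phi> \<circ> (T j \<circ> ?f)) has_vector_derivative blinfun_apply (\<phi>' (T j s)) (inverse (r j) *\<^sub>R v)) (at ?t)"
    by (rule vector_derivative_diff_chain_within[OF _ has_derivative_at_withinI])
  moreover have "open {t. \<bar>t - m j\<bar> < \<bar>r j\<bar>}"
    by (intro open_Collect_less continuous_intros)
  moreover have "?t \<in> {t. \<bar>t - m j\<bar> < \<bar>r j\<bar>}"
    using s r mult_strict_left_mono[of "\<bar>s\<bar>" 1 "\<bar>r j\<bar>"] by (simp add: abs_mult)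
  moreover have "(\<phi> \<circ> (T j \<circ> ?f)) t = curve D (ix j) t" if "t \<in> {t. \<bar>t - m j\<bar> < \<bar>r j\<bar>}" for t
  proof -
    have "\<bar>?f t\<bar> \<le> 1" using that r by (simp add: abs_divide)
    then have "?f t \<in> {-1..1}" unfolding abs_le_iff atLeastAtMost_iff by linarith
    then have "point D (pos j (?f t)) = \<phi> (T j (?f t))" by (rule point_pos[OF j])
    then show ?thesis using r by (simp add: point_def pos_def)
  qed
  ultimately have "(curve D (ix j) has_vector_derivative blinfun_apply (\<phi>' (T j s)) (inverse (r j) *\<^sub>R v)) (at ?t)"
    by (rule has_vector_derivative_transform_within_open)
  then show "(curve D (fst (pos j s)) has_vector_derivative inverse (r j) *\<^sub>R blinfun_apply (\<phi>' (T j s)) v) (at (snd (pos j s)))"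
    by (simp add: pos_def blinfun.scaleR_right)
qed

text \<open>
  Weights can be read off the picture, up to the orientations of the chart and of the two
  strands.
\<close>
lemma weight_pos:
  assumes i: "i < k" "\<bar>s\<bar> < 1" "(T i has_vector_derivative v) (at s)"
    and j: "j < k" "\<bar>t\<bar> < 1" "(T j has_vector_derivative w) (at t)"
    and m: "(i, s) \<noteq> (j, t)" "T i s = T j t" and W: "(i, s) \<in> W \<or> (j, t) \<in> W"
    and nz: "cross2 w v \<noteq> 0"
  shows "weight D (pos i s) = orientation * rsign (r i) * rsign (r j) * rsign (cross2 w v)"
proof -
  have st: "s \<in> {-1..1}" "t \<in> {-1..1}" using i j by auto
  have meet: "meet D (pos i s) (pos j t)" using m i j st by (simp add: meet_pos_iff)
  have "weight D (pos i s) = rsign (cross2 (tangent D (pos j t)) (tangent D (pos i s)))"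
    using weight_meet[OF diagram meet] W i j st by (auto simp: over_pos)
  also have "\<dots> = rsign (inverse (r j) * inverse (r i) *
      cross2 (blinfun_apply (\<phi>' (T i s)) w) (blinfun_apply (\<phi>' (T i s)) v))"
    by (simp add: tangent_pos[OF i] tangent_pos[OF j] cross2_scaleR m)
  also have "\<dots> = rsign (r j) * rsign (r i) *
      rsign (cross2 (blinfun_apply (\<phi>' (T i s)) w) (blinfun_apply (\<phi>' (T i s)) v))"
  proof -
    have "linear (blinfun_apply (\<phi>' (T i s)))"
      by (rule bounded_linear.linear) (rule blinfun.bounded_linear_right)
    then have "cross2 (blinfun_apply (\<phi>' (T i s)) w) (blinfun_apply (\<phi>' (T i s)) v) \<noteq> 0"
      using nz C1_diffeo_det_nonzero[OF chart] by (simp add: cross2_linear_image[of _ w v])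
    then show ?thesis
      using r_nonzero[OF i(1)] r_nonzero[OF j(1)] by (simp add: rsign_mult rsign_inverse)
  qed
  finally show ?thesis by (simp add: rsign_cross2_chart[OF nz] mult_ac)
qed

lemma weight_pos_0:
  assumes j: "j < k" "s \<in> {-1..1}"
    and "\<And>i t. i < k \<Longrightarrow> t \<in> {-1..1} \<Longrightarrow> (i, t) \<noteq> (j, s) \<Longrightarrow> T i t = T j s \<Longrightarrow> (i, t) \<notin> W \<and> (j, s) \<notin> W"
  shows "weight D (pos j s) = 0"
proof -
  have "pos j s \<notin> classical_passages D"
  proof
    assume "pos j s \<in> classical_passages D"
    then obtain y where y: "meet D (pos j s) y" "pos j s \<in> over D \<or> y \<in> over D"
      by (auto simp: classical_passages_iff)
    obtain i t where it: "i < k" "t \<in> {-1..1}" "y = pos i t"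
      using meet_inside[OF y(1) pos_inside[OF j]] by (rule insideE)
    then have "(i, t) \<noteq> (j, s)" "T i t = T j s"
      using y(1) j meet_pos_iff[of j i s t] by auto
    then show False using assms(3)[OF it(1,2)] y(2) it j by (simp add: over_pos)
  qed
  then show ?thesis by (simp add: weight_def)
qed

lemma weight_pos_virtual: "W = {} \<Longrightarrow> j < k \<Longrightarrow> s \<in> {-1..1} \<Longrightarrow> weight D (pos j s) = 0"
  by (rule weight_pos_0) simp_all

definition inner_crossings :: "crossing set" where
  "inner_crossings = {c \<in> SelfX D. fst c \<in> inside}"

lemma inner_crossings_eq:
  "inner_crossings = {(pos p s, pos q t) | p s q t. p < k \<and> q < k \<and> s \<in> {-1..1} \<and> t \<in> {-1..1} \<and>
     (p, s) \<noteq> (q, t) \<and> T p s = T q t \<and> (p, s) \<in> W \<and> ix p = ix q}" (is "_ = ?R")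
proof (intro set_eqI iffI)
  fix c assume c: "c \<in> inner_crossings"
  obtain x y where xy: "c = (x, y)" by (cases c)
  have "meet D x y" "x \<in> over D" "x \<in> inside" "fst x = fst y"
    using c by (simp_all add: xy inner_crossings_def SelfX_def classical_def)
  moreover from \<open>x \<in> inside\<close> obtain p s where "p < k" "s \<in> {-1..1}" "x = pos p s"
    by (rule insideE)
  moreover from meet_inside[OF \<open>meet D x y\<close> \<open>x \<in> inside\<close>]
  obtain q t where "q < k" "t \<in> {-1..1}" "y = pos q t"
    by (rule insideE)
  ultimately have "c = (pos p s, pos q t) \<and> p < k \<and> q < k \<and> s \<in> {-1..1} \<and> t \<in> {-1..1} \<and>
     (p, s) \<noteq> (q, t) \<and> T p s = T q t \<and> (p, s) \<in> W \<and> ix p = ix q"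
    using xy by (simp add: meet_pos_iff over_pos)
  then show "c \<in> ?R" by blast
next
  fix c assume "c \<in> ?R"
  then show "c \<in> inner_crossings"
    by (auto simp: inner_crossings_def SelfX_def classical_def meet_pos_iff over_pos intro!: pos_inside)
qed

definition inner_sum :: "(int \<Rightarrow> int \<Rightarrow> 'a::comm_ring_1) \<Rightarrow> 'a" where
  "inner_sum F = (\<Sum>c\<in>inner_crossings. of_int (crossing_sign D c) * F (ind_O D c) (ind_U D c))"

lemma inner_sum_virtual: "W = {} \<Longrightarrow> inner_sum F = 0"
  by (simp add: inner_sum_def inner_crossings_eq)

lemma index_sum_inner_outer:
  "index_sum F D = inner_sum F +
     (\<Sum>c\<in>{c \<in> SelfX D. fst c \<notin> inside}. of_int (crossing_sign D c) * F (ind_O D c) (ind_U D c))"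
  unfolding index_sum_def inner_sum_def inner_crossings_def
  using finite_SelfX[OF diagram]
  by (subst sum.union_disjoint[symmetric]) (auto intro!: sum.cong)

end

section \<open>Replacing a tangle\<close>

text \<open>
  The two sides of a move: equal chart and strand parameters, different tangles, and the same
  diagram outside.
\<close>
locale tangle_replacement =
  D: tangle_in_diagram k ix m r D T W \<phi> \<phi>' + E: tangle_in_diagram k ix m r E T' W' \<phi> \<phi>'
  for k ix m r D E T T' W W' \<phi> \<phi>' +
  assumes same_ncomp: "ncomp E = ncomp D"
    and same_point: "x \<in> passages D \<Longrightarrow> x \<notin> D.inside \<Longrightarrow> point E x = point D x"
    and same_over: "x \<in> passages D \<Longrightarrow> x \<notin> D.inside \<Longrightarrow> x \<in> over E \<longleftrightarrow> x \<in> over D"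
begin

lemma same_passages: "passages E = passages D"
  by (simp add: passages_def same_ncomp)

text \<open>
  The strands occupy a closed set of parameters, so the two curves agree near every parameter
  outside. The parameter 0 needs periodicity, since its left neighbours are represented in
  \<open>{0..<1}\<close> by parameters near 1.
\<close>
lemma same_tangent:
  assumes x: "x \<in> passages D" "x \<notin> D.inside"
  shows "tangent E x = tangent D x"
proof (rule tangent_eqI)
  obtain i t where it: "x = (i, t)" by (cases x)
  have i: "i < ncomp D" and t: "0 \<le> t" "t < 1" using x by (auto simp: it passages_def)
  define K where "K = (\<Union>j\<in>{j. j < k \<and> ix j = i}. {m j - \<bar>r j\<bar> .. m j + \<bar>r j\<bar>})"
  have K01: "u \<in> K \<Longrightarrow> 0 < u \<and> u < 1" for u
    using D.param_range by (fastforce simp: K_def)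
  have "closed K" unfolding K_def by (intro closed_UN) auto
  moreover have "closed ((\<lambda>u. u - 1) ` K)"
    using closed_translation[OF \<open>closed K\<close>, of "-1"] by (simp add: image_def)
  \<comment> \<open>A neighbourhood of \<open>t\<close> that avoids the strands and, for its negative part, their translates by \<open>-1\<close>.\<close>
  ultimately have op: "open ({-1<..<1} - K - (\<lambda>u. u - 1) ` K)" by (intro open_Diff) auto
  have per: "curve D i (u + 1) = curve D i u" "curve E i (u + 1) = curve E i u" for u
    using immersed[OF D.diagram i] immersed[OF E.diagram, of i] i
    by (auto simp: immersed_loop_def same_ncomp)
  have eq: "curve D i u = curve E i u" if "0 \<le> u" "u < 1" "u \<notin> K" for u
  proof -
    have "(i, u) \<notin> D.inside"
    proof
      assume "(i, u) \<in> D.inside"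
      then obtain j s where "j < k" "s \<in> {-1..1}" "(i, u) = D.pos j s" by (rule D.insideE)
      then have "ix j = i" "u \<in> {m j - \<bar>r j\<bar> .. m j + \<bar>r j\<bar>}"
        using D.snd_pos_range[of s j] by (auto simp: prod_eq_iff)
      then show False using that \<open>j < k\<close> by (simp only: K_def) blast
    qed
    then show ?thesis using same_point[of "(i, u)"] that i by (simp add: passages_def point_def)
  qed
  have "(curve E i has_vector_derivative tangent D (i, t)) (at t)"
  proof (rule has_vector_derivative_transform_within_open[OF tangent_has_vector_derivative[OF D.diagram i] op])
    show "t \<in> {-1<..<1} - K - (\<lambda>u. u - 1) ` K"
    proof -
      have "t \<notin> K"
      proof
        assume "t \<in> K"
        then obtain j where "j < k" "ix j = i" "m j - \<bar>r j\<bar> \<le> t" "t \<le> m j + \<bar>r j\<bar>" by (auto simp: K_def)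
        then show False using D.outside_interval[of j x] x by (auto simp: it)
      qed
      then show ?thesis using t K01 by force
    qed
    fix u assume u: "u \<in> {-1<..<1} - K - (\<lambda>u. u - 1) ` K"
    show "curve D i u = curve E i u"
    proof (cases "0 \<le> u")
      case True
      then show ?thesis using u eq by simp
    next
      case False
      have "u + 1 \<notin> K"
      proof
        assume "u + 1 \<in> K"
        then have "u \<in> (\<lambda>u. u - 1) ` K" by (rule rev_image_eqI) simp
        then show False using u by simp
      qed
      then show ?thesis using eq[of "u + 1"] u False by (simp add: per)
    qed
  qed
  then show "(curve E (fst x) has_vector_derivative tangent D x) (at (snd x))" by (simp add: it)
qed

lemma same_meet:
  assumes "x \<notin> D.inside"
  shows "meet E x y \<longleftrightarrow> meet D x y"
proof (cases "y \<in> D.inside")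
  case True
  then show ?thesis using assms meet_sym D.meet_inside E.meet_inside by blast
next
  case False
  then show ?thesis
    using assms by (auto simp: meet_def same_passages same_point)
qed

lemma same_classical_passages: "classical_passages E - D.inside = classical_passages D - D.inside"
proof -
  have "x \<in> classical_passages E \<longleftrightarrow> x \<in> classical_passages D" if x: "x \<notin> D.inside" for x
  proof -
    have "(meet E x y \<and> (x \<in> over E \<or> y \<in> over E)) = (meet D x y \<and> (x \<in> over D \<or> y \<in> over D))" for y
    proof (cases "meet D x y")
      case True
      then have "y \<notin> D.inside" using x meet_sym D.meet_inside by blast
      moreover have "x \<in> passages D" "y \<in> passages D" using True by (simp_all add: meet_def)
      ultimately show ?thesis using x by (simp add: same_meet same_over)
    qed (simp add: same_meet[OF x])
    then show ?thesis by (simp add: classical_passages_iff)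
  qed
  then show ?thesis by blast
qed

lemma same_weight:
  assumes x: "x \<notin> D.inside"
  shows "weight E x = weight D x"
proof (cases "x \<in> classical_passages D")
  case True
  then obtain y where y: "meet D x y" "x \<in> over D \<or> y \<in> over D" by (auto simp: classical_passages_iff)
  then have y': "y \<notin> D.inside" using x meet_sym D.meet_inside by blast
  have p: "x \<in> passages D" "y \<in> passages D" using y by (simp_all add: meet_def)
  show ?thesis
    using weight_meet[OF D.diagram y(1)] weight_meet[OF E.diagram, of x y] y(1) p x y'
    by (simp add: same_meet same_over same_tangent)
next
  case False
  then have "x \<notin> classical_passages E" using same_classical_passages x by blast
  then show ?thesis using False by (simp add: weight_def)
qed

lemma same_SelfX_outside: "{c \<in> SelfX E. fst c \<notin> D.inside} = {c \<in> SelfX D. fst c \<notin> D.inside}"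
proof -
  have "c \<in> SelfX E \<longleftrightarrow> c \<in> SelfX D" if c: "fst c \<notin> D.inside" for c
  proof -
    obtain x y where xy: "c = (x, y)" by (cases c)
    show ?thesis
      using c same_meet[of x y] same_over[of x]
      by (auto simp: xy SelfX_def classical_def meet_def)
  qed
  then show ?thesis by blast
qed

context
  assumes same_strand_sum: "\<And>j. j < k \<Longrightarrow> E.strand_sum j = D.strand_sum j"
begin

lemma same_outside_sum:
  "(\<Sum>z \<in> classical_passages E - D.inside. if z \<in> R then weight E z else 0)
    = (\<Sum>z \<in> classical_passages D - D.inside. if z \<in> R then weight D z else 0)"
  unfolding same_classical_passages by (rule sum.cong) (auto simp: same_weight)

lemma route_index_replacement_outside:
  assumes "x \<notin> D.inside" "y \<notin> D.inside" "fst x = fst y"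
  shows "route_index E x y = route_index D x y"
  unfolding D.route_index_outside[OF assms] E.route_index_outside[OF assms] same_outside_sum
  by (auto simp: same_strand_sum intro!: sum.cong)

lemma route_index_replacement_between:
  assumes pq: "p < k" "q < k" "p \<noteq> q" "ix p = ix q"
    and st: "s \<in> {-1..1}" "t \<in> {-1..1}" "s' \<in> {-1..1}" "t' \<in> {-1..1}"
    and eq: "E.after p s' + E.before q t' = D.after p s + D.before q t"
  shows "route_index E (D.pos p s') (D.pos q t') = route_index D (D.pos p s) (D.pos q t)"
  unfolding D.route_index_between[OF pq st(1,2)] E.route_index_between[OF pq st(3,4)] same_outside_sum
proof -
  have "(\<Sum>j\<in>{..<k} - {p, q}. if D.pos j 0 \<in> R then E.strand_sum j else 0)
      = (\<Sum>j\<in>{..<k} - {p, q}. if D.pos j 0 \<in> R then D.strand_sum j else 0)" for R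
    by (rule sum.cong) (auto simp: same_strand_sum)
  then show "(\<Sum>z \<in> classical_passages D - D.inside.
        if z \<in> route (D.pos p 0) (D.pos q 0) then weight D z else 0) +
      (\<Sum>j\<in>{..<k} - {p, q}. if D.pos j 0 \<in> route (D.pos p 0) (D.pos q 0) then E.strand_sum j else 0) +
      E.after p s' + E.before q t' =
      (\<Sum>z \<in> classical_passages D - D.inside.
        if z \<in> route (D.pos p 0) (D.pos q 0) then weight D z else 0) +
      (\<Sum>j\<in>{..<k} - {p, q}. if D.pos j 0 \<in> route (D.pos p 0) (D.pos q 0) then D.strand_sum j else 0) +
      D.after p s + D.before q t"
    using eq by simp
qed

text \<open>
  Equal strand sums settle all crossings outside; only the crossings inside the tangle remain to
  be compared, move by move.
\<close>
lemma index_sum_replacement: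
  assumes "E.inner_sum F = D.inner_sum F"
  shows "index_sum F E = index_sum F D"
proof -
  have "(\<Sum>c\<in>{c \<in> SelfX E. fst c \<notin> D.inside}. of_int (crossing_sign E c) * F (ind_O E c) (ind_U E c))
     = (\<Sum>c\<in>{c \<in> SelfX D. fst c \<notin> D.inside}. of_int (crossing_sign D c) * F (ind_O D c) (ind_U D c))"
  proof (rule sum.cong[OF same_SelfX_outside])
    fix c assume c: "c \<in> {c \<in> SelfX D. fst c \<notin> D.inside}"
    then have c': "c \<in> {c \<in> SelfX E. fst c \<notin> D.inside}" by (simp only: same_SelfX_outside)
    obtain x y where xy: "c = (x, y)" by (cases c)
    have m: "meet D x y" "fst x = fst y" "x \<notin> D.inside" and cl: "(x, y) \<in> classical D" "(x, y) \<in> classical E"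
      using c c' by (auto simp: xy SelfX_def classical_def)
    have y: "y \<notin> D.inside" using m meet_sym D.meet_inside by blast
    have "crossing_sign E c = crossing_sign D c"
      using crossing_sign_weight[OF D.diagram cl(1)] crossing_sign_weight[OF E.diagram cl(2)] same_weight[OF y]
      by (simp add: xy)
    moreover have "ind_O E c = ind_O D c" "ind_U E c = ind_U D c"
      using c c' m y by (simp_all add: ind_O_route ind_U_route xy route_index_replacement_outside)
    ultimately show "of_int (crossing_sign E c) * F (ind_O E c) (ind_U E c)
        = of_int (crossing_sign D c) * F (ind_O D c) (ind_U D c)" by simp
  qed
  then show ?thesis using assms by (simp add: D.index_sum_inner_outer E.index_sum_inner_outer)
qed

end

end

lemma local_move_replacement:
  assumes "virtual_link_diagram D" "virtual_link_diagram E"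
    and "box_tangle k T W" "box_tangle k T' W'"
    and lm: "local_move k T W T' W' D E"
  obtains ix m r \<phi> \<phi>' where "tangle_replacement k ix m r D E T T' W W' \<phi> \<phi>'"
proof -
  obtain \<phi> \<phi>' ix m r where nc: "ncomp E = ncomp D" and chart: "C1_diffeo \<phi> \<phi>'"
    and rng: "\<forall>j<k. ix j < ncomp D \<and> r j \<noteq> 0 \<and> 0 < m j - \<bar>r j\<bar> \<and> m j + \<bar>r j\<bar> < 1"
    and disj: "\<forall>i<k. \<forall>j<k. i \<noteq> j \<longrightarrow>
      (\<lambda>s. (ix i, m i + r i * s)) ` {-1..1} \<inter> (\<lambda>s. (ix j, m j + r j * s)) ` {-1..1} = {}"
    and out: "\<forall>x \<in> passages D - (\<Union>j<k. (\<lambda>s. (ix j, m j + r j * s)) ` {-1..1}).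
            point D x \<notin> \<phi> ` box2 \<and> point E x = point D x \<and> (x \<in> over E \<longleftrightarrow> x \<in> over D)"
    and ins: "\<forall>j<k. \<forall>s\<in>{-1..1}.
           point D (ix j, m j + r j * s) = \<phi> (T j s) \<and>
           point E (ix j, m j + r j * s) = \<phi> (T' j s) \<and>
           ((ix j, m j + r j * s) \<in> over D \<longleftrightarrow> (j, s) \<in> W) \<and>
           ((ix j, m j + r j * s) \<in> over E \<longleftrightarrow> (j, s) \<in> W')"
    using lm unfolding local_move_def Let_def by (elim conjE exE) (rule that)
  interpret strands k ix m r
    by unfold_locales (use rng disj in auto)
  have inside': "(\<Union>j<k. (\<lambda>s. (ix j, m j + r j * s)) ` {-1..1}) = inside"
    by (simp add: inside_def pos_def)
  note out = out[unfolded inside'] and ins = ins[folded pos_def]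
  have pE: "passages E = passages D" by (simp add: passages_def nc)
  have "tangle_replacement k ix m r D E T T' W W' \<phi> \<phi>'"
    by unfold_locales (use assms chart rng out ins nc in \<open>auto simp: pE\<close>)
  then show thesis by (rule that)
qed

section \<open>The moves\<close>

lemma has_vector_derivative_pair:
  assumes "(f has_real_derivative a) (at s)" "(g has_real_derivative b) (at s)"
  shows "((\<lambda>s. (f s, g s)) has_vector_derivative (a, b)) (at s)"
proof -
  have "((\<lambda>s. (f s, g s)) has_derivative (\<lambda>h. (a * h, b * h))) (at s)"
    by (rule has_derivative_Pair) (use assms in \<open>simp_all add: has_field_derivative_def\<close>)
  then show ?thesis by (simp add: has_vector_derivative_def mult.commute)
qed

lemma (in tangle_in_diagram) strand_sum_virtual: "W = {} \<Longrightarrow> j < k \<Longrightarrow> strand_sum j = 0"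
  unfolding strand_sum_def
  by (intro sum.neutral ballI weight_pos_virtual crossing_params_range)

lemma (in tangle_in_diagram) after_before_values:
  assumes "j < k"
  shows "after j (-1/2) = (if r j > 0 then weight D (pos j 0) + weight D (pos j (1/2)) else 0)"
    and "after j 0 = (if r j > 0 then weight D (pos j (1/2)) else weight D (pos j (-1/2)))"
    and "after j (1/2) = (if r j > 0 then 0 else weight D (pos j (-1/2)) + weight D (pos j 0))"
    and "before j (-1/2) = (if r j > 0 then 0 else weight D (pos j 0) + weight D (pos j (1/2)))"
    and "before j 0 = (if r j > 0 then weight D (pos j (-1/2)) else weight D (pos j (1/2)))"
    and "before j (1/2) = (if r j > 0 then weight D (pos j (-1/2)) + weight D (pos j 0) else 0)"
  using r_nonzero[OF assms]
  by (simp_all add: after_def before_def sum_crossing_params zero_less_mult_iff mult_less_0_iff)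

lemma abs_le_1_powers:
  fixes s :: real
  assumes "s \<in> {-1..1}"
  shows "-1 \<le> s" "s \<le> 1" "0 \<le> s\<^sup>2" "s\<^sup>2 \<le> 1" "-1 \<le> s ^ 5" "s ^ 5 \<le> 1" "0 \<le> s ^ 4" "s ^ 4 \<le> s\<^sup>2"
    "0 \<le> (1 - s\<^sup>2)\<^sup>2" "(1 - s\<^sup>2)\<^sup>2 \<le> 1"
proof -
  show s: "-1 \<le> s" "s \<le> 1" using assms by auto
  then have a: "\<bar>s\<bar> \<le> 1" by auto
  have *: "\<bar>s ^ n\<bar> \<le> 1" for n using power_le_one[OF _ a, of n] by (simp add: power_abs)
  show "-1 \<le> s ^ 5" "s ^ 5 \<le> 1" using *[of 5] unfolding abs_le_iff by linarith+
  show 2: "s\<^sup>2 \<le> 1" using *[of 2] unfolding abs_le_iff by linarith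
  show "s ^ 4 \<le> s\<^sup>2" using mult_left_le[OF 2, of "s\<^sup>2"] by (simp add: power4_eq_xxxx power2_eq_square mult.assoc)
  show "(1 - s\<^sup>2)\<^sup>2 \<le> 1" using 2 by (intro power_le_one) simp_all
qed simp_all

lemma mem_box2: "(a, b) \<in> box2 \<longleftrightarrow> -1 \<le> a \<and> a \<le> 1 \<and> -1 \<le> b \<and> b \<le> 1"
  by (auto simp: box2_def)

subsection \<open>Kinks\<close>

text \<open>
  Equal second coordinates give \<open>t = - s\<close>; then the first coordinate, an odd function of
  \<open>s\<close>, vanishes.
\<close>
lemma kink_crossing:
  "s \<noteq> t \<and> kink i s = kink j t \<longleftrightarrow> (s = 1/2 \<and> t = -1/2) \<or> (s = -1/2 \<and> t = 1/2)"
proof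
  assume *: "s \<noteq> t \<and> kink i s = kink j t"
  then have "t = - s" by (auto simp: kink_def power2_eq_iff)
  with * have "s ^ 3 - s / 4 = 0" by (simp add: kink_def)
  moreover have "s * ((2 * s - 1) * (2 * s + 1)) = 4 * (s ^ 3 - s / 4)"
    by (simp add: algebra_simps power3_eq_cube)
  ultimately have "s * ((2 * s - 1) * (2 * s + 1)) = 0" by simp
  moreover have "s \<noteq> 0" using * \<open>t = - s\<close> by auto
  ultimately have "s = 1/2 \<or> s = -1/2" by auto
  then show "(s = 1/2 \<and> t = -1/2) \<or> (s = -1/2 \<and> t = 1/2)" using \<open>t = - s\<close> by auto
next
  assume "(s = 1/2 \<and> t = -1/2) \<or> (s = -1/2 \<and> t = 1/2)"
  then show "s \<noteq> t \<and> kink i s = kink j t"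
    by (elim disjE conjE; hypsubst; simp add: kink_def power2_eq_square power3_eq_cube)
qed

lemma kink_derivative: "(kink j has_vector_derivative (3 * s\<^sup>2 - 1/4, 2 * s)) (at s)"
  unfolding kink_def[abs_def]
  by (rule has_vector_derivative_pair) (auto intro!: derivative_eq_intros simp: power2_eq_square)

lemma box_tangle_kink: "box_tangle 1 kink W"
  unfolding box_tangle_def
proof (intro conjI allI impI ballI)
  fix j and s :: real assume s: "s \<in> {-1..1}"
  have "s ^ 3 - s / 4 = s * (s\<^sup>2 - 1 / 4)" by (simp add: algebra_simps power2_eq_square power3_eq_cube)
  moreover have "\<bar>s * (s\<^sup>2 - 1 / 4)\<bar> \<le> 1 * 1"
    unfolding abs_mult
  proof (rule mult_mono)
    show "\<bar>s\<bar> \<le> 1" "\<bar>s\<^sup>2 - 1 / 4\<bar> \<le> 1"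
      using abs_le_1_powers[OF s] unfolding abs_le_iff by linarith+
  qed simp_all
  ultimately have "\<bar>s ^ 3 - s / 4\<bar> \<le> 1" by simp
  then show "kink j s \<in> box2"
    using abs_le_1_powers[OF s] unfolding kink_def mem_box2 abs_le_iff by linarith
next
  fix i j s t
  assume "i < (1::nat)" "j < (1::nat)" "(i, s) \<noteq> (j, t) \<and> kink i s = kink j t \<and> (i, s) \<in> W"
  then have "s \<noteq> t \<and> kink i s = kink j t" by auto
  then show "s \<in> crossing_params" "t \<in> crossing_params"
    unfolding kink_crossing by (auto simp: crossing_params_def)
qed

lemma box_tangle_no_kink: "box_tangle 1 no_kink {}"
proof -
  have "no_kink j s \<in> box2" if s: "s \<in> {-1..1}" for j s
    using abs_le_1_powers[OF s] unfolding no_kink_def mem_box2 by linarith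
  then show ?thesis by (simp add: box_tangle_def)
qed

lemma index_sum_virtual_replacement:
  assumes "virtual_link_diagram D" "virtual_link_diagram E"
    and "box_tangle k T {}" "box_tangle k T' {}" "local_move k T {} T' {} D E"
  shows "index_sum F E = index_sum F D"
proof -
  obtain ix m r \<phi> \<phi>' where "tangle_replacement k ix m r D E T T' {} {} \<phi> \<phi>'"
    using local_move_replacement assms by blast
  then interpret tangle_replacement k ix m r D E T T' "{}" "{}" \<phi> \<phi>' .
  show ?thesis
    by (rule index_sum_replacement)
      (simp_all add: D.strand_sum_virtual E.strand_sum_virtual D.inner_sum_virtual E.inner_sum_virtual)
qed

text \<open>
  The condition \<open>r 0 * s < 0\<close> says that \<open>s\<close> comes before \<open>- s\<close> on the component, so the
  route is the loop of the kink and not its complement.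
\<close>
lemma (in tangle_in_diagram) route_index_empty_kink:
  assumes k: "k = 1" and w: "weight D (pos 0 0) = 0" and s: "s = 1/2 \<or> s = -1/2" and rs: "r 0 * s < 0"
  shows "route_index D (pos 0 s) (pos 0 (- s)) = 0"
proof -
  have s1: "s \<in> {-1..1}" "- s \<in> {-1..1}" using s by auto
  have lt: "snd (pos 0 s) < snd (pos 0 (- s))" using rs by (simp add: pos_def)
  have "z \<in> inside" if z: "z \<in> route (pos 0 s) (pos 0 (- s))" for z
  proof -
    have "fst z = ix 0" "snd (pos 0 s) < snd z" "snd z < snd (pos 0 (- s))"
      using z lt by (auto simp: route_def open_arc_def)
    then have "m 0 - \<bar>r 0\<bar> \<le> snd z" "snd z \<le> m 0 + \<bar>r 0\<bar>"
      using snd_pos_range[OF s1(1), of 0] snd_pos_range[OF s1(2), of 0] by linarith+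
    then obtain u where "u \<in> {-1..1}" "z = pos 0 u"
      by (rule inside_interval[rotated 2]) (use k \<open>fst z = ix 0\<close> in simp_all)
    then show ?thesis using k pos_inside[of 0 u] by (simp only: less_one)
  qed
  then have out: "(\<Sum>z \<in> classical_passages D - inside.
      if z \<in> route (pos 0 s) (pos 0 (- s)) then weight D z else 0) = 0"
    by (intro sum.neutral) auto
  have "(if pos 0 u \<in> route (pos 0 s) (pos 0 (- s)) then weight D (pos 0 u) else 0) = 0"
    if u: "u \<in> crossing_params" for u
  proof (cases "u = 0")
    case False
    then have "u = s \<or> u = - s" using u s by (auto simp: crossing_params_def)
    moreover have "pos 0 u \<in> route (pos 0 s) (pos 0 (- s)) \<longleftrightarrow>
        snd (pos 0 s) < snd (pos 0 u) \<and> snd (pos 0 u) < snd (pos 0 (- s))"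
      using lt k crossing_params_range[OF u] by (simp add: mem_route_pos)
    ultimately show ?thesis by auto
  qed (simp add: w)
  then have "(\<Sum>j<k. \<Sum>u\<in>crossing_params.
      if pos j u \<in> route (pos 0 s) (pos 0 (- s)) then weight D (pos j u) else 0) = 0"
    by (intro sum.neutral ballI) (simp only: k lessThan_iff less_one)
  then show ?thesis unfolding route_index_inside_outside out by simp
qed

text \<open>
  Depending on the direction of the strand, the loop of the kink is the over or the under counting
  component. Its index is 0, and there \<open>F\<close> vanishes.
\<close>
lemma index_sum_classical_I:
  fixes F :: "int \<Rightarrow> int \<Rightarrow> 'a::comm_ring_1"
  assumes F: "\<And>a. F a 0 = 0" "\<And>b. F 0 b = 0"
    and D: "virtual_link_diagram D" and E: "virtual_link_diagram E"
    and W: "W = {(0, 1/2)} \<or> W = {(0, -1/2)}" and move: "move1 W D E"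
  shows "index_sum F E = index_sum F D"
proof -
  obtain ix m r \<phi> \<phi>' where "tangle_replacement 1 ix m r D E kink no_kink W {} \<phi> \<phi>'"
    using local_move_replacement[OF D E box_tangle_kink box_tangle_no_kink] move
    unfolding move1_def by blast
  then interpret tangle_replacement 1 ix m r D E kink no_kink W "{}" \<phi> \<phi>' .
  have k: "kink 0 (1/2) = kink 0 (-1/2)" using kink_crossing[of "1/2" "-1/2" 0 0] by simp
  have r: "rsign (r 0) * rsign (r 0) = 1" by (simp add: rsign_def)
  have "weight D (D.pos 0 (1/2)) = D.orientation * rsign (r 0) * rsign (r 0) *
      rsign (cross2 (3 * (-1/2)\<^sup>2 - 1/4, 2 * (-1/2)) (3 * (1/2)\<^sup>2 - 1/4, 2 * (1/2)))"
    by (rule D.weight_pos[OF _ _ kink_derivative _ _ kink_derivative])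
      (use W k in \<open>auto simp: cross2_def power2_eq_square\<close>)
  then have w1: "weight D (D.pos 0 (1/2)) = D.orientation"
    using r by (simp add: cross2_def power2_eq_square rsign_pos mult.assoc)
  have "weight D (D.pos 0 (-1/2)) = D.orientation * rsign (r 0) * rsign (r 0) *
      rsign (cross2 (3 * (1/2)\<^sup>2 - 1/4, 2 * (1/2)) (3 * (-1/2)\<^sup>2 - 1/4, 2 * (-1/2)))"
    by (rule D.weight_pos[OF _ _ kink_derivative _ _ kink_derivative])
      (use W k in \<open>auto simp: cross2_def power2_eq_square\<close>)
  then have w2: "weight D (D.pos 0 (-1/2)) = - D.orientation"
    using r by (simp add: cross2_def power2_eq_square rsign_neg mult.assoc)
  have w0: "weight D (D.pos 0 0) = 0"
  proof (rule D.weight_pos_0)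
    fix i t assume "i < 1" "(i, t) \<noteq> (0, 0)" "kink i t = kink 0 0"
    then show "(i, t) \<notin> W \<and> (0, 0) \<notin> W" using kink_crossing[of t 0 i 0] by auto
  qed simp_all
  have "F (ind_O D c) (ind_U D c) = 0" if c: "c \<in> D.inner_crossings" for c
  proof -
    obtain s t where st: "c = (D.pos 0 s, D.pos 0 t)" "s \<noteq> t" "kink 0 s = kink 0 t"
      using c unfolding D.inner_crossings_eq by auto
    then have s: "s = 1/2 \<or> s = -1/2" and t: "t = - s" using kink_crossing[of s t 0 0] by auto
    have "c \<in> SelfX D" using c unfolding D.inner_crossings_def by simp
    then have ind: "ind_O D c = route_index D (D.pos 0 s) (D.pos 0 (- s))"
      "ind_U D c = route_index D (D.pos 0 (- s)) (D.pos 0 s)"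
      using st t by (simp_all add: ind_O_route ind_U_route)
    have "r 0 * s \<noteq> 0" using D.r_nonzero[of 0] s by auto
    then have "r 0 * s < 0 \<or> r 0 * (- s) < 0" unfolding mult_minus_right by linarith
    then show ?thesis
    proof
      assume "r 0 * s < 0"
      then show ?thesis using D.route_index_empty_kink[OF refl w0 s] by (simp add: ind F)
    next
      assume "r 0 * (- s) < 0"
      then show ?thesis using D.route_index_empty_kink[OF refl w0, of "- s"] s by (auto simp: ind F)
    qed
  qed
  then have "D.inner_sum F = 0" unfolding D.inner_sum_def by (intro sum.neutral) simp
  moreover have "D.strand_sum 0 = 0"
    unfolding D.strand_sum_def sum_crossing_params w0 w1 w2 by simp
  ultimately show ?thesis
    by (intro index_sum_replacement) (simp_all add: E.inner_sum_virtual E.strand_sum_virtual del: One_nat_def)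
qed

subsection \<open>Bigons\<close>

lemma bigon_crossing:
  assumes "i < 2" "j < 2"
  shows "bigon i s = bigon j t \<longleftrightarrow> s = t \<and> (i = j \<or> s = 1/2 \<or> s = -1/2)"
proof -
  have "s\<^sup>2 = 1 / 4 \<longleftrightarrow> s = 1/2 \<or> s = -1/2"
    using power2_eq_iff[of s "1/2"] by (simp add: power_divide)
  then show ?thesis using assms by (auto simp: bigon_def less_2_cases_iff)
qed

lemma bigon_derivative: "(bigon j has_vector_derivative (1, if j = 0 then 0 else 2 * s)) (at s)"
  unfolding bigon_def[abs_def]
  by (rule has_vector_derivative_pair) (auto intro!: derivative_eq_intros)

lemma box_tangle_bigon: "box_tangle 2 bigon W"
  unfolding box_tangle_def
proof (intro conjI allI impI ballI)
  fix j and s :: real assume s: "s \<in> {-1..1}"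
  show "bigon j s \<in> box2"
    using abs_le_1_powers[OF s] unfolding bigon_def mem_box2 by (cases "j = 0") (simp_all only: if_True if_False simp_thms, linarith+)
next
  fix i j s t
  assume "i < (2::nat)" "j < (2::nat)" "(i, s) \<noteq> (j, t) \<and> bigon i s = bigon j t \<and> (i, s) \<in> W"
  then show "s \<in> crossing_params" "t \<in> crossing_params"
    by (auto simp: bigon_crossing crossing_params_def)
qed

lemma box_tangle_no_bigon: "box_tangle 2 no_bigon {}"
  unfolding box_tangle_def
proof (intro conjI allI impI ballI)
  fix j and s :: real assume s: "s \<in> {-1..1}"
  have "-1 \<le> s ^ 4 - s\<^sup>2 + 3 / 4" "s ^ 4 - s\<^sup>2 + 3 / 4 \<le> 1"
    using abs_le_1_powers[OF s] by linarith+
  then show "no_bigon j s \<in> box2"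
    using s by (simp add: no_bigon_def mem_box2)
qed auto

lemma over_passages_virtual: "over_passages k T {} = {}"
  by (simp add: over_passages_def)

text \<open>
  At the two crossings the tangents of the strands form frames of opposite orientation, so weights
  and signs are opposite. Between the crossings the index changes by the weights passed on the two
  strands, and these cancel or do not occur, depending on the relative orientation.
\<close>
lemma index_sum_classical_II:
  fixes F :: "int \<Rightarrow> int \<Rightarrow> 'a::comm_ring_1"
  assumes D: "virtual_link_diagram D" and E: "virtual_link_diagram E"
    and A: "A = {(0, 1)} \<or> A = {(1, 0)}" and move: "move2 A D E"
  shows "index_sum F E = index_sum F D"
proof -
  define W where "W = over_passages 2 bigon A"
  obtain p q :: nat where pq: "A = {(p, q)}" "(p = 0 \<and> q = 1) \<or> (p = 1 \<and> q = 0)"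
    using A by auto
  have W: "(i, s) \<in> W \<longleftrightarrow> i = p \<and> (s = 1/2 \<or> s = -1/2)" for i s
    using pq by (auto simp: W_def over_passages_def bigon_crossing)
  obtain ix m r \<phi> \<phi>' where "tangle_replacement 2 ix m r D E bigon no_bigon W {} \<phi> \<phi>'"
    using local_move_replacement[OF D E box_tangle_bigon box_tangle_no_bigon] move
    unfolding move2_def W_def by blast
  then interpret tangle_replacement 2 ix m r D E bigon no_bigon W "{}" \<phi> \<phi>' .
  define \<kappa> where "\<kappa> = D.orientation * rsign (r 0) * rsign (r 1)"
  have w: "weight D (D.pos i s) = D.orientation * rsign (r i) * rsign (r j) *
      rsign (cross2 (1, if j = 0 then 0 else 2 * s) (1, if i = 0 then 0 else 2 * s))"
    if "i < 2" "j < 2" "i \<noteq> j" "s = 1/2 \<or> s = -1/2" for i j s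
    by (rule D.weight_pos[OF _ _ bigon_derivative _ _ bigon_derivative])
      (use that pq W in \<open>auto simp: cross2_def bigon_crossing less_2_cases_iff\<close>)
  have w0: "weight D (D.pos 0 (1/2)) = - \<kappa>" "weight D (D.pos 0 (-1/2)) = \<kappa>"
    and w1: "weight D (D.pos 1 (1/2)) = \<kappa>" "weight D (D.pos 1 (-1/2)) = - \<kappa>"
    using w[of 0 1 "1/2"] w[of 0 1 "-1/2"] w[of 1 0 "1/2"] w[of 1 0 "-1/2"]
    by (simp_all add: \<kappa>_def cross2_def rsign_pos rsign_neg mult_ac)
  have w00: "weight D (D.pos j 0) = 0" if "j < 2" for j
    by (rule D.weight_pos_0) (use that in \<open>auto simp: bigon_crossing\<close>)
  have wpq: "weight D (D.pos q (-1/2)) = - weight D (D.pos q (1/2))"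
    using pq w0 w1 by auto
  have inner0: "D.inner_sum F = 0"
  proof (cases "ix p = ix q")
    case False
    then have "D.inner_crossings = {}"
      unfolding D.inner_crossings_eq W using pq by (auto simp: bigon_crossing less_2_cases_iff)
    then show ?thesis by (simp add: D.inner_sum_def)
  next
    case True
    let ?c = "\<lambda>s. (D.pos p s, D.pos q s)"
    have inner: "D.inner_crossings = {?c (1/2), ?c (-1/2)}"
    proof (intro set_eqI iffI)
      fix c assume "c \<in> D.inner_crossings"
      then obtain s q' t where c: "c = (D.pos p s, D.pos q' t)" and q': "p < 2" "q' < 2"
        and ne: "(p, s) \<noteq> (q', t)" and eq: "bigon p s = bigon q' t" and s: "s = 1/2 \<or> s = -1/2"
        unfolding D.inner_crossings_eq W by blast
      have "s = t" using bigon_crossing[OF q'] eq by blast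
      moreover have "q' = q" using ne \<open>s = t\<close> q' pq(2) by (elim disjE conjE) simp_all
      ultimately have "c = ?c s" using c by simp
      then show "c \<in> {?c (1/2), ?c (-1/2)}" using s by blast
    next
      fix c assume "c \<in> {?c (1/2), ?c (-1/2)}"
      then obtain s where c: "c = ?c s" and s: "s = 1/2 \<or> s = -1/2" by blast
      have "s \<in> {-1..1}" using s by (elim disjE) simp_all
      moreover have "p < 2" "q < 2" "(p, s) \<noteq> (q, s)" using pq(2) by (elim disjE conjE; simp)+
      moreover have "bigon p s = bigon q s"
        using bigon_crossing[OF \<open>p < 2\<close> \<open>q < 2\<close>] s by blast
      ultimately show "c \<in> D.inner_crossings"
        unfolding D.inner_crossings_eq W using c s True by blast
    qed
    have ne: "?c (1/2) \<noteq> ?c (-1/2)" using D.pos_eq_iff[of p p "1/2" "-1/2"] pq by auto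
    have S: "?c (1/2) \<in> SelfX D" "?c (-1/2) \<in> SelfX D"
      using inner by (auto simp: D.inner_crossings_def)
    then have "crossing_sign D (?c (1/2)) = weight D (D.pos q (1/2))"
      "crossing_sign D (?c (-1/2)) = weight D (D.pos q (-1/2))"
      by (auto simp: SelfX_def crossing_sign_weight[OF D.diagram])
    then have sign: "crossing_sign D (?c (-1/2)) = - crossing_sign D (?c (1/2))"
      by (simp only: wpq)
    have less: "0 < (2::nat)" "1 < (2::nat)" by simp_all
    note vals = D.after_before_values[OF less(1)] D.after_before_values[OF less(2)]
      w0 w1 w00[OF less(1)] w00[OF less(2)]
    have ab: "D.after 0 (-1/2) + D.before 1 (-1/2) = D.after 0 (1/2) + D.before 1 (1/2)"
      "D.after 1 (-1/2) + D.before 0 (-1/2) = D.after 1 (1/2) + D.before 0 (1/2)"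
      by (simp_all only: vals) simp_all
    have idx: "route_index D (D.pos i (-1/2)) (D.pos j (-1/2)) = route_index D (D.pos i (1/2)) (D.pos j (1/2))"
      if "(i = 0 \<and> j = 1) \<or> (i = 1 \<and> j = 0)" "ix i = ix j" for i j
    proof -
      have *: "i < 2" "j < 2" "i \<noteq> j" using that by auto
      have "D.after i (-1/2) + D.before j (-1/2) = D.after i (1/2) + D.before j (1/2)"
        using ab that(1) by (elim disjE conjE) (simp_all only:)
      then show ?thesis using
        D.route_index_between[OF *(1,2,3) that(2), of "1/2" "1/2"]
        D.route_index_between[OF *(1,2,3) that(2), of "-1/2" "-1/2"]
        by (simp add: add.assoc)
    qed
    have ind: "ind_O D (?c (-1/2)) = ind_O D (?c (1/2))" "ind_U D (?c (-1/2)) = ind_U D (?c (1/2))"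
      using idx[of p q] idx[of q p] pq True ind_U_route[OF S(1)] ind_U_route[OF S(2)]
      by (auto simp: ind_O_route)
    let ?g = "\<lambda>c. of_int (crossing_sign D c) * F (ind_O D c) (ind_U D c)"
    have two: "sum g {x, y} = g x + g y" if "x \<noteq> y" for g :: "crossing \<Rightarrow> 'a" and x y
      using that by simp
    have "D.inner_sum F = ?g (?c (1/2)) + ?g (?c (-1/2))"
      unfolding D.inner_sum_def inner by (rule two[OF ne])
    also have "?g (?c (-1/2)) = - ?g (?c (1/2))"
      unfolding ind sign by simp
    finally show ?thesis by simp
  qed
  show ?thesis
  proof (rule index_sum_replacement)
    fix j :: nat assume "j < 2"
    then have "j = 0 \<or> j = 1" by auto
    then show "E.strand_sum j = D.strand_sum j"
      using w0 w1 w00 by (auto simp: E.strand_sum_virtual D.strand_sum_def sum_crossing_params)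
  qed (simp add: E.inner_sum_virtual inner0)
qed

subsection \<open>Triangles\<close>

text \<open>
  The common parameter at which strands \<open>i\<close> and \<open>j\<close> of the triangle cross. The sum
  \<open>i + j\<close> identifies an unordered pair of distinct strands.
\<close>
definition triangle_param :: "real \<Rightarrow> nat \<Rightarrow> nat \<Rightarrow> real" where
  "triangle_param e i j = (if i + j = 1 then 0 else if i + j = 2 then e / 2 else - e / 2)"

text \<open>
  The derivative of the second coordinate of \<^const>\<open>triangle\<close>.
\<close>
definition triangle_slope :: "real \<Rightarrow> nat \<Rightarrow> real \<Rightarrow> real" where
  "triangle_slope e j s =
     (if j = 0 then 1/2 else if j = 1 then -1/2 else - (e * (16/9) * s * (1 - s\<^sup>2)))"

lemma triangle_param_values:
  "triangle_param e 0 1 = 0" "triangle_param e 1 0 = 0"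
  "triangle_param e 0 2 = e / 2" "triangle_param e 2 0 = e / 2"
  "triangle_param e 1 2 = - e / 2" "triangle_param e 2 1 = - e / 2"
  by (simp_all add: triangle_param_def)

lemma less_3_cases: "i < 3 \<longleftrightarrow> i = 0 \<or> i = 1 \<or> i = (2::nat)"
  by auto

text \<open>
  The difference of the two sides is a quartic with the root \<open>1/2\<close>; the cofactor has no zero
  on the part of the interval where both sides can be equal.
\<close>
lemma arch_meets_line:
  fixes s :: real
  assumes "s \<in> {-1..1}"
  shows "s / 2 = 4/9 * (1 - s\<^sup>2)\<^sup>2 \<longleftrightarrow> s = 1/2"
proof
  assume eq: "s / 2 = 4/9 * (1 - s\<^sup>2)\<^sup>2"
  have "(2 * s - 1) * (4 * s ^ 3 + 2 * s\<^sup>2 - 7 * s - 8) = 8 * (1 - s\<^sup>2)\<^sup>2 - 9 * s"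
    by (simp add: algebra_simps power2_eq_square power3_eq_cube)
  then have 0: "(2 * s - 1) * (4 * s ^ 3 + 2 * s\<^sup>2 - 7 * s - 8) = 0" using eq by simp
  have "0 \<le> s" using eq zero_le_power2[of "1 - s\<^sup>2"] by linarith
  then have "s * (4 * s\<^sup>2 + 2 * s - 7) \<le> 0"
    using abs_le_1_powers[OF assms] by (intro mult_nonneg_nonpos) linarith+
  moreover have "4 * s ^ 3 + 2 * s\<^sup>2 - 7 * s - 8 = s * (4 * s\<^sup>2 + 2 * s - 7) - 8"
    by (simp add: algebra_simps power2_eq_square power3_eq_cube)
  ultimately have "4 * s ^ 3 + 2 * s\<^sup>2 - 7 * s - 8 \<noteq> 0" by linarith
  with 0 show "s = 1/2" by simp
next
  assume "s = 1/2"
  then show "s / 2 = 4/9 * (1 - s\<^sup>2)\<^sup>2" by (simp only:) (simp add: power2_eq_square)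
qed

lemma triangle_crossing:
  assumes e: "e = 1 \<or> e = -1" and ij: "i < 3" "j < 3" and s: "s \<in> {-1..1}"
  shows "triangle e i s = triangle e j t \<longleftrightarrow> s = t \<and> (i = j \<or> s = triangle_param e i j)"
proof -
  have up: "s / 2 = e * (4/9) * (1 - s\<^sup>2)\<^sup>2 \<longleftrightarrow> s = e / 2"
    using e
  proof
    assume "e = -1"
    then show ?thesis using arch_meets_line[of "- s"] s by auto
  qed (use arch_meets_line[OF s] in auto)
  have down: "- s / 2 = e * (4/9) * (1 - s\<^sup>2)\<^sup>2 \<longleftrightarrow> s = - e / 2"
    using e
  proof
    assume "e = 1"
    then show ?thesis using arch_meets_line[of "- s"] s by auto
  next
    assume "e = -1"
    then show ?thesis using arch_meets_line[OF s] by auto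
  qed
  have level: "s / 2 = - s / 2 \<longleftrightarrow> s = 0" "- s / 2 = s / 2 \<longleftrightarrow> s = 0" by auto
  have tri: "triangle e 0 u = (u, u / 2)" "triangle e 1 u = (u, - u / 2)"
    "triangle e 2 u = (u, e * (4/9) * (1 - u\<^sup>2)\<^sup>2)" for u
    by (simp_all add: triangle_def)
  have num: "(0::nat) \<noteq> 1" "(1::nat) \<noteq> 0" "(0::nat) \<noteq> 2" "(2::nat) \<noteq> 0" "(1::nat) \<noteq> 2" "(2::nat) \<noteq> 1"
    by simp_all
  show ?thesis
  proof (cases "s = t")
    case True
    have flip: "a = s / 2 \<longleftrightarrow> s / 2 = a" "a = - s / 2 \<longleftrightarrow> - s / 2 = a" for a by auto
    have "triangle e i s = triangle e j s \<longleftrightarrow> i = j \<or> s = triangle_param e i j"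
      using ij unfolding less_3_cases
      by (elim disjE; hypsubst; simp only: tri prod.inject triangle_param_values num simp_thms level
          up down up[unfolded flip(1)[symmetric]] down[unfolded flip(2)[symmetric]])
    with True show ?thesis by simp
  next
    case False
    then show ?thesis by (simp add: triangle_def)
  qed
qed

lemma triangle_derivative: "(triangle e j has_vector_derivative (1, triangle_slope e j s)) (at s)"
  unfolding triangle_def[abs_def] triangle_slope_def
  by (rule has_vector_derivative_pair)
    (auto intro!: derivative_eq_intros simp: field_simps power2_eq_square)

lemma triangle_param_range:
  assumes "e = 1 \<or> e = -1"
  shows "triangle_param e i j \<in> crossing_params"
  using assms by (auto simp: triangle_param_def crossing_params_def)

lemma triangle_param_inj:
  assumes "e = 1 \<or> e = -1" "p < 3" "q < 3" "q' < 3" "p \<noteq> q" "p \<noteq> q'"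
    and "triangle_param e p q = triangle_param e p q'"
  shows "q = q'"
  using assms unfolding less_3_cases by (elim disjE; hypsubst; simp add: triangle_param_def)

lemma triangle_param_commute: "triangle_param e p q = triangle_param e q p"
  by (simp add: triangle_param_def add.commute)

lemma box_tangle_triangle:
  assumes e: "e = 1 \<or> e = -1"
  shows "box_tangle 3 (triangle e) W"
  unfolding box_tangle_def
proof (intro conjI allI impI ballI)
  fix j and s :: real assume s: "s \<in> {-1..1}"
  have "\<bar>e * (4/9) * (1 - s\<^sup>2)\<^sup>2\<bar> \<le> 1"
    using e abs_le_1_powers[OF s] by (auto simp: abs_mult)
  then show "triangle e j s \<in> box2"
    using abs_le_1_powers[OF s] by (simp add: triangle_def mem_box2 abs_le_iff)
next
  fix i j s t
  assume "i < (3::nat)" "j < (3::nat)" "s \<in> {-1..1}"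
    and *: "(i, s) \<noteq> (j, t) \<and> triangle e i s = triangle e j t \<and> (i, s) \<in> W"
  then have "s = t" "s = triangle_param e i j"
    using triangle_crossing[OF e] by blast+
  then show "s \<in> crossing_params" "t \<in> crossing_params"
    using triangle_param_range[OF e, of i j] by simp_all
qed

text \<open>
  The orientation of the frame formed by the tangents of \<open>q\<close> and \<open>p\<close> at their crossing
  when all strands run from left to right.
\<close>
definition triangle_sign :: "nat \<Rightarrow> nat \<Rightarrow> int" where
  "triangle_sign p q = (if (p, q) \<in> {(0, 1), (0, 2), (2, 1)} then 1 else -1)"

text \<open>
  The slopes at the crossings are \<open>\<plusminus>1/2\<close> for strands 0 and 1, and \<open>-2/3\<close> and \<open>2/3\<close> for
  strand 2 where it crosses 0 and 1. They do not depend on \<open>e\<close>, so no crossing sign changes in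
  a triangle move.
\<close>
lemma rsign_triangle_slope:
  assumes "e = 1 \<or> e = -1" "p < 3" "q < 3" "p \<noteq> q" "s = triangle_param e p q"
  shows "rsign (cross2 (1, triangle_slope e q s) (1, triangle_slope e p s)) = triangle_sign p q"
    "cross2 (1, triangle_slope e q s) (1, triangle_slope e p s) \<noteq> 0"
  using assms unfolding less_3_cases
  by (elim disjE; hypsubst; simp add: triangle_param_def triangle_slope_def triangle_sign_def
      cross2_def rsign_def power2_eq_square)+

lemma over_passages_triangle:
  assumes e: "e = 1 \<or> e = -1" and A: "A \<subseteq> {(p, q). p < 3 \<and> q < 3 \<and> p \<noteq> q}"
    and s: "s \<in> {-1..1}"
  shows "(p, s) \<in> over_passages 3 (triangle e) A \<longleftrightarrow> (\<exists>q. (p, q) \<in> A \<and> s = triangle_param e p q)"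
proof
  assume "(p, s) \<in> over_passages 3 (triangle e) A"
  then obtain q t where q: "p < 3" "q < 3" "(p, q) \<in> A" "triangle e p s = triangle e q t"
    by (auto simp: over_passages_def)
  moreover have "p \<noteq> q" using q A by auto
  ultimately have "s = triangle_param e p q" using triangle_crossing[OF e q(1,2) s] by blast
  with q show "\<exists>q. (p, q) \<in> A \<and> s = triangle_param e p q" by blast
next
  assume "\<exists>q. (p, q) \<in> A \<and> s = triangle_param e p q"
  then obtain q where q: "(p, q) \<in> A" "s = triangle_param e p q" by blast
  then have "p < 3" "q < 3" using A by auto
  moreover have "triangle e p s = triangle e q s"
    using triangle_crossing[OF e calculation s] q by blast
  ultimately show "(p, s) \<in> over_passages 3 (triangle e) A"
    using q s unfolding over_passages_def by blast
qed

lemma over_passage_triangle_param: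
  assumes e: "e = 1 \<or> e = -1" and A: "A \<subseteq> {(p, q). p < 3 \<and> q < 3 \<and> p \<noteq> q}"
    and pq: "p < 3" "q < 3" "p \<noteq> q"
  shows "(p, triangle_param e p q) \<in> over_passages 3 (triangle e) A \<longleftrightarrow> (p, q) \<in> A"
proof -
  have "q = q'" if "(p, q') \<in> A" "triangle_param e p q = triangle_param e p q'" for q'
    using triangle_param_inj[OF e pq(1,2) _ pq(3) _ that(2)] A that(1) by auto
  then show ?thesis
    unfolding over_passages_triangle[OF e A crossing_params_range[OF triangle_param_range[OF e]]]
    by blast
qed

text \<open>
  The picture before the move is \<open>e = 1\<close>, the one after it \<open>e = -1\<close>; both are treated at once.
\<close>
locale triangle_in_diagram =
  tangle_in_diagram 3 ix m r D "triangle e" "over_passages 3 (triangle e) A" \<phi> \<phi>'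
  for ix m r D e A \<phi> \<phi>' +
  assumes e: "e = 1 \<or> e = -1" and A: "A \<subseteq> {(p, q). p < 3 \<and> q < 3 \<and> p \<noteq> q}"
begin

text \<open>
  The weight of the passage of \<open>p\<close> through its crossing with \<open>q\<close>. It does not mention \<open>e\<close>,
  and is thus the same before and after the move.
\<close>
definition strand_weight :: "nat \<Rightarrow> nat \<Rightarrow> int" where
  "strand_weight p q = (if (p, q) \<in> A \<or> (q, p) \<in> A
     then orientation * rsign (r p) * rsign (r q) * triangle_sign p q else 0)"

lemma weight_triangle:
  assumes pq: "p < 3" "q < 3" "p \<noteq> q"
  shows "weight D (pos p (triangle_param e p q)) = strand_weight p q"
proof -
  let ?s = "triangle_param e p q"
  have s: "?s \<in> {-1..1}" "\<bar>?s\<bar> < 1"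
    using triangle_param_range[OF e] crossing_params_range crossing_params_interior by blast+
  have W: "(p, ?s) \<in> over_passages 3 (triangle e) A \<longleftrightarrow> (p, q) \<in> A"
    "(q, ?s) \<in> over_passages 3 (triangle e) A \<longleftrightarrow> (q, p) \<in> A"
    using over_passage_triangle_param[OF e A pq] over_passage_triangle_param[OF e A, of q p] pq
      triangle_param_commute[of e p q] by simp_all
  have T: "triangle e p ?s = triangle e q ?s" using triangle_crossing[OF e pq(1,2) s(1)] by blast
  show ?thesis
  proof (cases "(p, q) \<in> A \<or> (q, p) \<in> A")
    case True
    have "weight D (pos p ?s) = orientation * rsign (r p) * rsign (r q) *
        rsign (cross2 (1, triangle_slope e q ?s) (1, triangle_slope e p ?s))"
      by (rule weight_pos[OF _ s(2) triangle_derivative _ s(2) triangle_derivative])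
        (use pq True W T rsign_triangle_slope(2)[OF e pq refl] in simp_all)
    then show ?thesis using True by (simp add: strand_weight_def rsign_triangle_slope(1)[OF e pq refl])
  next
    case False
    have "weight D (pos p ?s) = 0"
    proof (rule weight_pos_0[OF pq(1) s(1)])
      fix i t assume it: "i < 3" "t \<in> {-1..1}" "(i, t) \<noteq> (p, ?s)" "triangle e i t = triangle e p ?s"
      then have t: "t = ?s" "i \<noteq> p" "t = triangle_param e i p"
        using triangle_crossing[OF e it(1) pq(1) it(2)] by blast+
      then have "?s = triangle_param e p i" using triangle_param_commute[of e i p] by simp
      then have "i = q"
        using triangle_param_inj[OF e pq(1,2) it(1) pq(3) t(2)[symmetric]] by simp
      then show "(i, t) \<notin> over_passages 3 (triangle e) A \<and> (p, ?s) \<notin> over_passages 3 (triangle e) A"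
        using False W \<open>t = ?s\<close> by simp
    qed
    then show ?thesis using False by (simp add: strand_weight_def)
  qed
qed

lemma weight_triangle_no_crossing:
  assumes p: "p < 3" and s: "s \<in> {-1..1}" and no: "\<And>q. q < 3 \<Longrightarrow> q \<noteq> p \<Longrightarrow> s \<noteq> triangle_param e p q"
  shows "weight D (pos p s) = 0"
proof (rule weight_pos_0[OF p s])
  fix i t assume it: "i < 3" "t \<in> {-1..1}" "(i, t) \<noteq> (p, s)" "triangle e i t = triangle e p s"
  then have "t = s" "s = triangle_param e i p" "i \<noteq> p"
    using triangle_crossing[OF e it(1) p it(2)] by auto
  then have False using no[OF it(1)] triangle_param_commute[of e i p] by simp
  then show "(i, t) \<notin> over_passages 3 (triangle e) A \<and> (p, s) \<notin> over_passages 3 (triangle e) A" ..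
qed

text \<open>
  The nine special passages. Replacing \<open>e\<close> by \<open>- e\<close> exchanges the order of the two crossings
  on each strand.
\<close>
lemma triangle_weights:
  "weight D (pos 0 0) = strand_weight 0 1"
  "weight D (pos 0 (e / 2)) = strand_weight 0 2"
  "weight D (pos 0 (- e / 2)) = 0"
  "weight D (pos 1 0) = strand_weight 1 0"
  "weight D (pos 1 (- e / 2)) = strand_weight 1 2"
  "weight D (pos 1 (e / 2)) = 0"
  "weight D (pos 2 (e / 2)) = strand_weight 2 0"
  "weight D (pos 2 (- e / 2)) = strand_weight 2 1"
  "weight D (pos 2 0) = 0"
proof -
  have range: "0 \<in> {-1..1::real}" "e / 2 \<in> {-1..1}" "- e / 2 \<in> {-1..1}" using e by auto
  show "weight D (pos 0 0) = strand_weight 0 1" "weight D (pos 0 (e / 2)) = strand_weight 0 2"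
    "weight D (pos 1 0) = strand_weight 1 0" "weight D (pos 1 (- e / 2)) = strand_weight 1 2"
    "weight D (pos 2 (e / 2)) = strand_weight 2 0" "weight D (pos 2 (- e / 2)) = strand_weight 2 1"
    using weight_triangle[of 0 1] weight_triangle[of 0 2] weight_triangle[of 1 0]
      weight_triangle[of 1 2] weight_triangle[of 2 0] weight_triangle[of 2 1]
    unfolding triangle_param_values by simp_all
  show "weight D (pos 0 (- e / 2)) = 0"
  proof (rule weight_triangle_no_crossing[OF _ range(3)])
    fix q :: nat assume "q < 3" "q \<noteq> 0"
    then show "- e / 2 \<noteq> triangle_param e 0 q" using e by (auto simp: triangle_param_def)
  qed simp
  show "weight D (pos 1 (e / 2)) = 0"
  proof (rule weight_triangle_no_crossing[OF _ range(2)])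
    fix q :: nat assume "q < 3" "q \<noteq> 1"
    then show "e / 2 \<noteq> triangle_param e 1 q" using e by (auto simp: triangle_param_def)
  qed simp
  show "weight D (pos 2 0) = 0"
  proof (rule weight_triangle_no_crossing[OF _ range(1)])
    fix q :: nat assume "q < 3" "q \<noteq> 2"
    then show "0 \<noteq> triangle_param e 2 q" using e by (auto simp: triangle_param_def)
  qed simp
qed

definition triangle_crossing_of :: "nat \<times> nat \<Rightarrow> crossing" where
  "triangle_crossing_of = (\<lambda>(p, q). (pos p (triangle_param e p q), pos q (triangle_param e p q)))"

lemma inner_crossings_triangle:
  "inner_crossings = triangle_crossing_of ` {(p, q) \<in> A. ix p = ix q}"
proof (intro set_eqI iffI)
  fix c assume "c \<in> inner_crossings"
  then obtain p s q t where c: "c = (pos p s, pos q t)" and pq: "p < 3" "q < 3"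
    and s: "s \<in> {-1..1}" "(p, s) \<noteq> (q, t)" "triangle e p s = triangle e q t"
    and W: "(p, s) \<in> over_passages 3 (triangle e) A" and ix: "ix p = ix q"
    unfolding inner_crossings_eq by blast
  have st: "s = t" "p \<noteq> q" "s = triangle_param e p q"
    using triangle_crossing[OF e pq s(1)] s(2,3) by auto
  obtain q' where q': "(p, q') \<in> A" "s = triangle_param e p q'"
    using W over_passages_triangle[OF e A s(1)] by blast
  then have "q' < 3" "p \<noteq> q'" using A by auto
  then have "q = q'" using triangle_param_inj[OF e pq(1,2) _ st(2)] st q' by auto
  then show "c \<in> triangle_crossing_of ` {(p, q) \<in> A. ix p = ix q}"
    using q' c st ix by (intro image_eqI[of _ _ "(p, q)"]) (simp_all add: triangle_crossing_of_def)
next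
  fix c assume "c \<in> triangle_crossing_of ` {(p, q) \<in> A. ix p = ix q}"
  then obtain p q where pq: "(p, q) \<in> A" "ix p = ix q" "c = triangle_crossing_of (p, q)" by blast
  define s where "s = triangle_param e p q"
  have s: "s \<in> {-1..1}"
    unfolding s_def using triangle_param_range[OF e] crossing_params_range by blast
  have less: "p < 3" "q < 3" "p \<noteq> q" using pq A by auto
  have "(p, s) \<in> over_passages 3 (triangle e) A"
    using over_passages_triangle[OF e A s] pq s_def by blast
  moreover have "triangle e p s = triangle e q s"
    using triangle_crossing[OF e less(1,2) s] s_def by blast
  moreover have "c = (pos p s, pos q s)" using pq by (simp add: triangle_crossing_of_def s_def)
  ultimately show "c \<in> inner_crossings"
    unfolding inner_crossings_eq using s less pq(2) by blast
qed

lemma inner_sum_triangle: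
  "inner_sum F = (\<Sum>(p, q)\<in>{(p, q) \<in> A. ix p = ix q}. of_int (strand_weight q p) *
     F (route_index D (pos p (triangle_param e p q)) (pos q (triangle_param e p q)))
       (route_index D (pos q (triangle_param e p q)) (pos p (triangle_param e p q))))"
proof -
  have inj: "inj_on triangle_crossing_of {(p, q) \<in> A. ix p = ix q}"
  proof (rule inj_onI)
    fix a b assume ab: "a \<in> {(p, q) \<in> A. ix p = ix q}" "b \<in> {(p, q) \<in> A. ix p = ix q}"
      "triangle_crossing_of a = triangle_crossing_of b"
    obtain p q p' q' where "a = (p, q)" "b = (p', q')" by (cases a, cases b)
    moreover have "p < 3" "q < 3" "p' < 3" "q' < 3" using calculation ab A by auto
    ultimately show "a = b"
      using ab(3) pos_eq_iff crossing_params_range triangle_param_range[OF e]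
      by (simp add: triangle_crossing_of_def)
  qed
  show ?thesis
    unfolding inner_sum_def inner_crossings_triangle sum.reindex[OF inj] o_def
  proof (rule sum.cong[OF refl])
    fix a assume a: "a \<in> {(p, q) \<in> A. ix p = ix q}"
    obtain p q where pq: "a = (p, q)" by (cases a)
    have less: "p < 3" "q < 3" "p \<noteq> q" using a A pq by auto
    have S: "triangle_crossing_of (p, q) \<in> SelfX D"
      using a pq inner_crossings_triangle by (auto simp: inner_crossings_def)
    then have "crossing_sign D (triangle_crossing_of (p, q)) = weight D (pos q (triangle_param e p q))"
      by (simp add: triangle_crossing_of_def SelfX_def crossing_sign_weight[OF diagram])
    also have "\<dots> = strand_weight q p"
      using weight_triangle[of q p] less by (simp add: triangle_param_commute[of e p q])
    finally have "crossing_sign D (triangle_crossing_of (p, q)) = strand_weight q p" .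
    then show "of_int (crossing_sign D (triangle_crossing_of a)) *
        F (ind_O D (triangle_crossing_of a)) (ind_U D (triangle_crossing_of a))
      = (case a of (p, q) \<Rightarrow> of_int (strand_weight q p) *
     F (route_index D (pos p (triangle_param e p q)) (pos q (triangle_param e p q)))
       (route_index D (pos q (triangle_param e p q)) (pos p (triangle_param e p q))))"
      using ind_U_route[OF S] by (simp add: pq ind_O_route) (simp add: triangle_crossing_of_def)
  qed
qed

end

text \<open>
  For a crossing of \<open>p\<close> and \<open>q\<close> the third strand may be met on \<open>p\<close> after the crossing and
  on \<open>q\<close> before it. The move exchanges on both strands whether it is met or not. If it was met on
  exactly one of them, the two weights are equal; if on both or none, they are opposite. Either way
  the sum is unchanged. Both alternatives of the hypothesis on \<open>A\<close> matter: a third strand that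
  is classical on only one of \<open>p\<close> and \<open>q\<close> would change the index. The second alternative
  covers the mixed move and, with \<open>A = {}\<close>, the virtual one.
\<close>
lemma index_sum_triangle_move:
  assumes D: "virtual_link_diagram D" and E: "virtual_link_diagram E"
    and A: "A \<subseteq> {(p, q). p < 3 \<and> q < 3 \<and> p \<noteq> q}"
    and all_or_one: "(\<forall>p<3. \<forall>q<3. p \<noteq> q \<longrightarrow> (p, q) \<in> A \<or> (q, p) \<in> A) \<or> A \<subseteq> {(0, 1), (1, 0)}"
    and move: "move3 A D E"
  shows "index_sum F E = index_sum F D"
proof -
  obtain ix m r \<phi> \<phi>' where "tangle_replacement 3 ix m r D E (triangle 1) (triangle (-1))
      (over_passages 3 (triangle 1) A) (over_passages 3 (triangle (-1)) A) \<phi> \<phi>'"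
    using local_move_replacement[OF D E box_tangle_triangle box_tangle_triangle] move
    unfolding move3_def by blast
  then interpret tangle_replacement 3 ix m r D E "triangle 1" "triangle (-1)"
    "over_passages 3 (triangle 1) A" "over_passages 3 (triangle (-1)) A" \<phi> \<phi>' .
  interpret TD: triangle_in_diagram ix m r D 1 A \<phi> \<phi>'
    by unfold_locales (use A in simp_all)
  interpret TE: triangle_in_diagram ix m r E "-1" A \<phi> \<phi>'
    by unfold_locales (use A in simp_all)
  let ?w = TD.strand_weight
  have wD: "weight D (D.pos 0 (-1/2)) = 0" "weight D (D.pos 0 0) = ?w 0 1" "weight D (D.pos 0 (1/2)) = ?w 0 2"
    "weight D (D.pos 1 (-1/2)) = ?w 1 2" "weight D (D.pos 1 0) = ?w 1 0" "weight D (D.pos 1 (1/2)) = 0"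
    "weight D (D.pos 2 (-1/2)) = ?w 2 1" "weight D (D.pos 2 0) = 0" "weight D (D.pos 2 (1/2)) = ?w 2 0"
    using TD.triangle_weights by simp_all
  have wE: "weight E (D.pos 0 (-1/2)) = ?w 0 2" "weight E (D.pos 0 0) = ?w 0 1" "weight E (D.pos 0 (1/2)) = 0"
    "weight E (D.pos 1 (-1/2)) = 0" "weight E (D.pos 1 0) = ?w 1 0" "weight E (D.pos 1 (1/2)) = ?w 1 2"
    "weight E (D.pos 2 (-1/2)) = ?w 2 0" "weight E (D.pos 2 0) = 0" "weight E (D.pos 2 (1/2)) = ?w 2 1"
    using TE.triangle_weights by simp_all
  have sums: "E.strand_sum j = D.strand_sum j" if "j < 3" for j
    using that unfolding less_3_cases
    by (elim disjE; hypsubst; simp only: D.strand_sum_def E.strand_sum_def sum_crossing_params wD wE; simp)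
  have less: "0 < (3::nat)" "1 < (3::nat)" "2 < (3::nat)" by simp_all
  note vals = D.after_before_values[OF less(1)] D.after_before_values[OF less(2)] D.after_before_values[OF less(3)]
    E.after_before_values[OF less(1)] E.after_before_values[OF less(2)] E.after_before_values[OF less(3)] wD wE
  have params: "triangle_param 1 0 1 = 0" "triangle_param 1 1 0 = 0"
    "triangle_param 1 0 2 = 1/2" "triangle_param 1 2 0 = 1/2"
    "triangle_param 1 1 2 = -1/2" "triangle_param 1 2 1 = -1/2"
    "triangle_param (-1) 0 1 = 0" "triangle_param (-1) 1 0 = 0"
    "triangle_param (-1) 0 2 = -1/2" "triangle_param (-1) 2 0 = -1/2"
    "triangle_param (-1) 1 2 = 1/2" "triangle_param (-1) 2 1 = 1/2"
    unfolding triangle_param_values by simp_all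
  have key: "E.after p (triangle_param (-1) p q) + E.before q (triangle_param (-1) p q)
      = D.after p (triangle_param 1 p q) + D.before q (triangle_param 1 p q)"
    if pqA: "(p, q) \<in> A \<or> (q, p) \<in> A" for p q
    using all_or_one
  proof
    assume all: "\<forall>p<3. \<forall>q<3. p \<noteq> q \<longrightarrow> (p, q) \<in> A \<or> (q, p) \<in> A"
    have w: "?w p q = D.orientation * rsign (r p) * rsign (r q) * triangle_sign p q"
      if "p < 3" "q < 3" "p \<noteq> q" for p q
      using all that by (simp add: TD.strand_weight_def)
    have ws: "?w 0 1 = D.orientation * rsign (r 0) * rsign (r 1)" "?w 1 0 = - (D.orientation * rsign (r 0) * rsign (r 1))"
      "?w 0 2 = D.orientation * rsign (r 0) * rsign (r 2)" "?w 2 0 = - (D.orientation * rsign (r 0) * rsign (r 2))"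
      "?w 2 1 = D.orientation * rsign (r 1) * rsign (r 2)" "?w 1 2 = - (D.orientation * rsign (r 1) * rsign (r 2))"
      by (simp_all add: w triangle_sign_def)
    have "p < 3" "q < 3" "p \<noteq> q" using pqA A by auto
    then show ?thesis
      unfolding less_3_cases
      by (elim disjE; hypsubst; (simp only: params vals ws rsign_def)?; simp)
  next
    assume one: "A \<subseteq> {(0, 1), (1, 0)}"
    have ws: "?w 0 2 = 0" "?w 1 2 = 0" using one by (auto simp: TD.strand_weight_def)
    have "(p = 0 \<and> q = 1) \<or> (p = 1 \<and> q = 0)" using one pqA by auto
    then show ?thesis
      by (elim disjE conjE; hypsubst; simp only: params vals ws; simp)
  qed
  show ?thesis
  proof (rule index_sum_replacement[OF sums])
    have idx: "route_index E (D.pos p (triangle_param (-1) p q)) (D.pos q (triangle_param (-1) p q))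
        = route_index D (D.pos p (triangle_param 1 p q)) (D.pos q (triangle_param 1 p q))"
      if "(p, q) \<in> A \<or> (q, p) \<in> A" "ix p = ix q" for p q
    proof -
      have less: "p < 3" "q < 3" "p \<noteq> q" using that(1) A by auto
      show ?thesis
        by (rule route_index_replacement_between[OF sums less that(2) _ _ _ _ key[OF that(1)]])
          (use triangle_param_range crossing_params_range in blast)+
    qed
    show "E.inner_sum F = D.inner_sum F"
      unfolding TD.inner_sum_triangle TE.inner_sum_triangle
    proof (rule sum.cong[OF refl])
      fix a assume a: "a \<in> {(p, q) \<in> A. ix p = ix q}"
      obtain p q where pq: "a = (p, q)" by (cases a)
      have "(p, q) \<in> A" "ix p = ix q" using a pq by auto
      then show "(case a of (p, q) \<Rightarrow> of_int (TE.strand_weight q p) *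
           F (route_index E (D.pos p (triangle_param (-1) p q)) (D.pos q (triangle_param (-1) p q)))
             (route_index E (D.pos q (triangle_param (-1) p q)) (D.pos p (triangle_param (-1) p q))))
        = (case a of (p, q) \<Rightarrow> of_int (?w q p) *
           F (route_index D (D.pos p (triangle_param 1 p q)) (D.pos q (triangle_param 1 p q)))
             (route_index D (D.pos q (triangle_param 1 p q)) (D.pos p (triangle_param 1 p q))))"
        using idx[of p q] idx[of q p] triangle_param_commute[of _ p q] by (simp add: pq)
    qed
  qed
qed

section \<open>Invariance\<close>

lemma index_sum_reidemeister:
  fixes F :: "int \<Rightarrow> int \<Rightarrow> 'a::comm_ring_1"
  assumes F: "\<And>a. F a 0 = 0" "\<And>b. F 0 b = 0"
    and D: "virtual_link_diagram D" and E: "virtual_link_diagram E"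
    and move: "generalized_reidemeister D E"
  shows "index_sum F D = index_sum F E"
  using move
proof cases
  case (classical_I W)
  then show ?thesis by (intro index_sum_classical_I[of F, OF F(1) F(2) D E, symmetric])
next
  case (classical_II A)
  then show ?thesis by (intro index_sum_classical_II[OF D E, symmetric])
next
  case (classical_III h A)
  have "\<forall>p<3. \<forall>q<3. p \<noteq> q \<longrightarrow> (p, q) \<in> A \<or> (q, p) \<in> A"
  proof (intro allI impI)
    fix p q :: nat assume pq: "p < 3" "q < 3" "p \<noteq> q"
    then have "h p \<noteq> h q" using classical_III(1) by (auto dest: inj_onD)
    then show "(p, q) \<in> A \<or> (q, p) \<in> A" using pq by (auto simp: classical_III(2))
  qed
  moreover have "A \<subseteq> {(p, q). p < 3 \<and> q < 3 \<and> p \<noteq> q}" by (auto simp: classical_III(2))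
  ultimately show ?thesis
    using index_sum_triangle_move[OF D E _ _ classical_III(3), of F] by simp
next
  case virtual_I
  then show ?thesis
    using index_sum_virtual_replacement[OF D E box_tangle_kink box_tangle_no_kink, of F]
    unfolding move1_def by simp
next
  case virtual_II
  then show ?thesis
    using index_sum_virtual_replacement[OF D E box_tangle_bigon box_tangle_no_bigon, of F]
    unfolding move2_def over_passages_virtual by simp
next
  case virtual_III
  then show ?thesis using index_sum_triangle_move[OF D E, of "{}" F] by simp
next
  case (mixed_IV A)
  then have "A \<subseteq> {(p, q). p < 3 \<and> q < 3 \<and> p \<noteq> q}" "A \<subseteq> {(0, 1), (1, 0)}" by auto
  then show ?thesis using index_sum_triangle_move[OF D E _ _ mixed_IV(2), of F] by simp
qed

lemma index_sum_equivalent: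
  fixes F :: "int \<Rightarrow> int \<Rightarrow> 'a::comm_ring_1"
  assumes F: "\<And>a. F a 0 = 0" "\<And>b. F 0 b = 0" and "equivalent D D'"
  shows "index_sum F D = index_sum F D'"
proof -
  have step: "index_sum F D = index_sum F E" if "elementary_step D E" for D E
    using that index_sum_same_loops index_sum_isotopic index_sum_reidemeister[of F, OF F(1) F(2)]
    unfolding elementary_step_def by blast
  have "equivclp elementary_step D D'" using assms(3) by (simp add: equivalent_def)
  then show ?thesis
    by (induction rule: equivclp_induct) (use step in fastforce)+
qed

theorem theorem7:
  fixes D D' :: diagram and n :: int
  assumes "virtual_link_diagram D" and "virtual_link_diagram D'"
    and "n \<noteq> 0"
    and "equivalent D D'"
  shows "J_O n D = J_O n D' \<and> J_U n D = J_U n D' \<and>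
         P_O D = P_O D' \<and> P_U D = P_U D' \<and> P_OU D = P_OU D'"
proof (intro conjI)
  note eq = index_sum_equivalent[OF _ _ assms(4)]
  show "J_O n D = J_O n D'"
    unfolding J_O_index_sum[OF assms(1)] J_O_index_sum[OF assms(2)] by (rule eq) (use assms(3) in auto)
  show "J_U n D = J_U n D'"
    unfolding J_U_index_sum[OF assms(1)] J_U_index_sum[OF assms(2)] by (rule eq) (use assms(3) in auto)
  show "P_O D = P_O D'"
    unfolding P_O_index_sum[OF assms(1)] P_O_index_sum[OF assms(2)] by (rule eq) (auto simp: t_pow_0)
  show "P_U D = P_U D'"
    unfolding P_U_index_sum[OF assms(1)] P_U_index_sum[OF assms(2)] by (rule eq) (auto simp: t_pow_0)
  show "P_OU D = P_OU D'"
    unfolding P_OU_index_sum by (rule eq) (auto simp: t_pow_0)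
qed

end
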